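(* Let $\mathfrak g=V=\mathfrak{sl}(2,\mathbb C)$, with $V$ the adjoint representation, let $S(V)$ be the $\beta\gamma$-system of $V$, let $\Theta=\widehat\rho(\mathcal O(\mathfrak{sl}(2,\mathbb C),-K))\subset S(V)$, and let $\mathcal A=\widehat\psi(\mathcal O(\mathfrak{sl}(2,\mathbb C),-\tfrac38K))\subset S(V)$, where $K$ is the Killing form of $\mathfrak{sl}(2,\mathbb C)$. Then the commutant $S(V)^{\Theta_+}=\mathrm{Com}(\Theta,S(V))$ is strongly generated by the three elements $$v^{e}(z)=4\big(:\gamma^{h'}(z)\gamma^{h'}(z):+:\gamma^{e'}(z)\gamma^{f'}(z):\big),$$ $$v^{f}(z)=-\tfrac1{16}\big(:\beta^{h}(z)\beta^{h}(z):+4:\beta^{e}(z)\beta^{f}(z):\big),$$ $$v^{h}(z)=:\beta^{h}(z)\gamma^{h'}(z):+:\beta^{e}(z)\gamma^{e'}(z):+:\beta^{f}(z)\gamma^{f'}(z):,$$ and $S(V)^{\Theta_+}=\mathcal A$.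
   Context: Vertex algebras are over $\mathbb C$; the $n$-th product of $u,v$ is written $u\circ_n v$ (so $Y(u,z)v=\sum_n (u\circ_n v)z^{-n-1}$), $:uv:=u\circ_{-1}v$ is the Wick (normally ordered) product, $\partial$ is the translation operator, and $u(z)v(w)\sim\sum_{n\ge0}(u\circ_n v)(w)(z-w)^{-n-1}$ denotes the OPE. A subset $\{u_i\}$ strongly generates a vertex algebra $U$ if $U$ is spanned by the (iterated) normally ordered monomials $:\partial^{k_1}u_{i_1}\cdots\partial^{k_m}u_{i_m}:$, $m\ge0$, $k_j\ge0$. Commutant: for a subset $U$ of a vertex algebra $W$, $\mathrm{Com}(U,W)=\{v\in W\mid u\circ_n v=0\ \text{for all } u\in U,\ n\ge0\}$, also written $W^{U_+}$. Current algebra: for a Lie algebra $\mathfrak g$ with symmetric invariant bilinear form $B$, $\mathcal O(\mathfrak g,B)$ is the universal affine vertex algebra generated by fields $u(z)$, $u\in\mathfrak g$, with $u(z)v(w)\sim B(u,v)(z-w)^{-2}+[u,v](w)(z-w)^{-1}$; its underlying space is the module $N(\mathfrak g,B)$ induced from the one-dimensional representation of $\mathfrak g\otimes\mathbb C[t]\oplus\mathbb C c$ with $\mathfrak g\otimes\mathbb C[t]$ acting by $0$ and $c$ by $1$, to $\widehat{\mathfrak g}=\mathfrak g\otimes\mathbb C[t,t^{-1}]\oplus\mathbb Cc$, with $[u\otimes t^n,v\otimes t^m]=[u,v]\otimes t^{m+n}+nB(u,v)\delta_{m+n,0}c$. $\beta\gamma$-system: for a finite dimensional vector space $V$, $S(V)$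 is the vertex algebra generated by fields $\beta^x(z)$ ($x\in V$, linear in $x$), $\gamma^{x'}(z)$ ($x'\in V^*$, linear in $x'$) with OPEs $\beta^x(z)\gamma^{x'}(w)\sim\langle x',x\rangle(z-w)^{-1}$, $\beta^x(z)\beta^y(w)\sim0$, $\gamma^{x'}(z)\gamma^{y'}(w)\sim0$; writing $\beta^x(z)=\sum_n\beta^x(n)z^{-n-1}$, $\gamma^{x'}(z)=\sum_n\gamma^{x'}(n)z^{-n-1}$, its underlying space is the Fock module generated by a vacuum vector killed by $\beta^x(n),\gamma^{x'}(n)$ for $n\ge0$, with PBW basis given by monomials in the modes $\beta^x(n),\gamma^{x'}(n)$, $n<0$. For a representation $\rho:\mathfrak g\to\mathrm{End}\,V$ with basis $x_i$ of $V$ and dual basis $x_i'$, there is a vertex algebra homomorphism $\widehat\rho:\mathcal O(\mathfrak g,B)\to S(V)$, with $B(u,v)=-\mathrm{Tr}(\rho(u)\rho(v))$, sending $u(z)\mapsto -\sum_i:\beta^{\rho(u)(x_i)}(z)\gamma^{x_i'}(z):$. For the adjoint representation, $B=-K$. For $V=\mathfrak{sl}(2,\mathbb C)$ with standard basis $e,f,h$ ($[e,f]=h$, $[h,e]=2e$, $[h,f]=-2f$) and dual basis $e',f',h'$ of $V^*$, $\widehat\psi:\mathcal O(\mathfrak{sl}(2,\mathbb C),-\tfrac38K)\to S(V)^{\Theta_+}$ is the vertex algebra homomorphism given on generators by $e(z)\mapsto v^e(z)$, $f(z)\mapsto v^f(z)$, $h(z)\mapsto v^h(z)$ (equivalently $v^e=\frac12\sum_i:\gamma^{x_i'}\gamma^{x_i'}:$,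 $v^f=-\frac12\sum_i:\beta^{x_i}\beta^{x_i}:$, $v^h=\sum_i:\beta^{x_i}\gamma^{x_i'}:$ for a $K$-orthonormal basis $x_i$ of $V$ with dual basis $x_i'$). *)

theory Defs
  imports "HOL-Analysis.Analysis" "HOL-Library.Poly_Mapping" "HOL-Library.Multiset"
begin

section \<open>Vertex algebras over the complex numbers\<close>

text \<open>
  The underlying space is a whole type, whose addition is that of its class. The term
  \<open>nprod W u n v\<close> is the \<open>n\<close>-th product \<open>u \<circ>\<^sub>n v\<close>, that is, the action on \<open>v\<close> of the mode \<open>u(n)\<close> of
  the field \<open>Y(u,z) = \<Sum>\<^sub>n u(n) z\<^bsup>-n-1\<^esup>\<close>. There is no parity: all vertex algebras are even.
\<close>

record 'w vertex_alg =
  vscale :: "complex \<Rightarrow> 'w \<Rightarrow> 'w"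
  vacuum :: "'w"
  nprod :: "'w \<Rightarrow> int \<Rightarrow> 'w \<Rightarrow> 'w"

text \<open>
  The last axiom is the Borcherds identity. By truncation all but finitely many of its summands
  vanish, so both uses of \<^const>\<open>Sum_any\<close> are genuine finite sums.
\<close>

locale vertex_algebra =
  fixes W :: "'w::ab_group_add vertex_alg"
  assumes vspace: "vector_space (vscale W)"
    and nprod_linear_right: "Vector_Spaces.linear (vscale W) (vscale W) (\<lambda>v. nprod W u n v)"
    and nprod_linear_left: "Vector_Spaces.linear (vscale W) (vscale W) (\<lambda>u. nprod W u n v)"
    and truncation: "\<exists>N. \<forall>n\<ge>N. nprod W u n v = 0"
    and vacuum_left: "nprod W (vacuum W) n v = (if n = -1 then v else 0)"
    and creation: "nprod W u (-1) (vacuum W) = u"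
    and creation_regular: "n \<ge> 0 \<Longrightarrow> nprod W u n (vacuum W) = 0"
    and borcherds:
      "Sum_any (\<lambda>j::nat. vscale W (of_int m gchoose j)
          (nprod W (nprod W u (n + int j) v) (m + k - int j) w)) =
       Sum_any (\<lambda>j::nat. vscale W ((-1) ^ j * (of_int n gchoose j))
          (nprod W u (m + n - int j) (nprod W v (k + int j) w)
           - vscale W ((-1) powi n) (nprod W v (n + k - int j) (nprod W u (m + int j) w))))"

definition wick :: "'w vertex_alg \<Rightarrow> 'w \<Rightarrow> 'w \<Rightarrow> 'w" where
  "wick W u v = nprod W u (-1) v"

definition translation :: "'w vertex_alg \<Rightarrow> 'w \<Rightarrow> 'w" where
  "translation W u = nprod W u (-2) (vacuum W)"

definition va_hom ::
    "'a::ab_group_add vertex_alg \<Rightarrow> 'w::ab_group_add vertex_alg \<Rightarrow> ('a \<Rightarrow> 'w) \<Rightarrow> bool" where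
  "va_hom U W \<phi> \<longleftrightarrow>
     Vector_Spaces.linear (vscale U) (vscale W) \<phi> \<and>
     \<phi> (vacuum U) = vacuum W \<and>
     (\<forall>u n v. \<phi> (nprod U u n v) = nprod W (\<phi> u) n (\<phi> v))"

definition commutant :: "'w::ab_group_add vertex_alg \<Rightarrow> 'w set \<Rightarrow> 'w set" where
  "commutant W U = {v. \<forall>u\<in>U. \<forall>n\<ge>0. nprod W u n v = 0}"

text \<open>
  Iterated normally ordered products associate to the right, \<open>:abc: = :a(:bc:):\<close>, and the empty
  product is the vacuum.
\<close>

definition normally_ordered_monomials :: "'w vertex_alg \<Rightarrow> 'w set \<Rightarrow> 'w set" where
  "normally_ordered_monomials W X =
     {foldr (\<lambda>(k, x). wick W ((translation W ^^ k) x)) ks (vacuum W) | ks :: (nat \<times> 'w) list.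
        snd ` set ks \<subseteq> X}"

text \<open>
  Here \<open>U\<close> is a vertex subalgebra of \<open>W\<close>, so that its Wick product and translation are those of
  \<open>W\<close>.
\<close>

definition strongly_generates ::
    "'w::ab_group_add vertex_alg \<Rightarrow> 'w set \<Rightarrow> 'w set \<Rightarrow> bool" where
  "strongly_generates W X U \<longleftrightarrow>
     X \<subseteq> U \<and> module.span (vscale W) (normally_ordered_monomials W X) = U"


section \<open>Lie algebras, invariant forms, dual bases\<close>

locale lie_algebra = vector_space sc
  for sc :: "complex \<Rightarrow> 'g::ab_group_add \<Rightarrow> 'g" +
  fixes bracket :: "'g \<Rightarrow> 'g \<Rightarrow> 'g"
  assumes bracket_linear_right: "Vector_Spaces.linear sc sc (\<lambda>y. bracket x y)"
    and bracket_linear_left: "Vector_Spaces.linear sc sc (\<lambda>x. bracket x y)"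
    and bracket_self: "bracket x x = 0"
    and jacobi: "bracket x (bracket y z) + bracket y (bracket z x) + bracket z (bracket x y) = 0"

definition dual_space :: "(complex \<Rightarrow> 'v::ab_group_add \<Rightarrow> 'v) \<Rightarrow> ('v \<Rightarrow> complex) set" where
  "dual_space sc = {\<phi>. Vector_Spaces.linear sc (*) \<phi>}"

text \<open>\<open>dual_vec sc bs b\<close> is the member \<open>b'\<close> of the basis dual to \<open>bs\<close>.\<close>

definition dual_vec :: "(complex \<Rightarrow> 'v::ab_group_add \<Rightarrow> 'v) \<Rightarrow> 'v set \<Rightarrow> 'v \<Rightarrow> 'v \<Rightarrow> complex" where
  "dual_vec sc bs b = (\<lambda>x. module.representation sc bs x b)"

definition endo_trace ::
    "(complex \<Rightarrow> 'v::ab_group_add \<Rightarrow> 'v) \<Rightarrow> 'v set \<Rightarrow> ('v \<Rightarrow> 'v) \<Rightarrow> complex" where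
  "endo_trace sc bs f = (\<Sum>b\<in>bs. dual_vec sc bs b (f b))"

definition killing_form ::
    "(complex \<Rightarrow> 'g::ab_group_add \<Rightarrow> 'g) \<Rightarrow> 'g set \<Rightarrow> ('g \<Rightarrow> 'g \<Rightarrow> 'g) \<Rightarrow> 'g \<Rightarrow> 'g \<Rightarrow> complex" where
  "killing_form sc bs bracket u v =
     endo_trace sc bs (\<lambda>x. bracket u (bracket v x))"

locale invariant_form = lie_algebra sc bracket
  for sc :: "complex \<Rightarrow> 'g::ab_group_add \<Rightarrow> 'g" and bracket :: "'g \<Rightarrow> 'g \<Rightarrow> 'g" +
  fixes B :: "'g \<Rightarrow> 'g \<Rightarrow> complex"
  assumes form_linear: "Vector_Spaces.linear sc (*) (B x)"
    and form_sym: "B x y = B y x"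
    and form_invariant: "B (bracket x y) z = B x (bracket y z)"


section \<open>The universal affine vertex algebra\<close>

text \<open>
  The module \<open>N(\<g>, B)\<close> is presented by generators and relations. Words in the letters
  \<open>Loop u n\<close> (for \<open>u \<otimes> t\<^sup>n\<close>) and \<open>Central\<close> (for \<open>c\<close>) form a basis of the free associative
  algebra on these letters. The relations \<open>loop_linear\<close>, \<open>loop_bracket\<close> and \<open>central\<close> span the
  two-sided ideal whose quotient is the enveloping algebra of the affine Lie algebra; the relations
  \<open>annihilate\<close> and \<open>level_one\<close> span the left ideal by which one divides to induce from the
  one-dimensional representation on which \<open>u \<otimes> t\<^sup>n\<close>, \<open>n \<ge> 0\<close>, acts by \<open>0\<close> and \<open>c\<close> by \<open>1\<close>.
\<close>

datatype 'g affine_letter = Loop 'g int | Central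

type_synonym 'g free_alg = "'g affine_letter list \<Rightarrow>\<^sub>0 complex"

abbreviation free_scale :: "complex \<Rightarrow> 'g free_alg \<Rightarrow> 'g free_alg" where
  "free_scale c \<equiv> Poly_Mapping.map ((*) c)"

abbreviation word :: "'g affine_letter list \<Rightarrow> 'g free_alg" where
  "word ls \<equiv> Poly_Mapping.single ls 1"

inductive_set affine_relators ::
    "(complex \<Rightarrow> 'g::ab_group_add \<Rightarrow> 'g) \<Rightarrow> ('g \<Rightarrow> 'g \<Rightarrow> 'g) \<Rightarrow> ('g \<Rightarrow> 'g \<Rightarrow> complex)
       \<Rightarrow> 'g free_alg set"
  for sc bracket B where
  loop_linear:
    "word (p @ [Loop (sc a u + sc b v) n] @ q)
       - free_scale a (word (p @ [Loop u n] @ q))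
       - free_scale b (word (p @ [Loop v n] @ q)) \<in> affine_relators sc bracket B"
| loop_bracket:
    "word (p @ [Loop u n, Loop v m] @ q) - word (p @ [Loop v m, Loop u n] @ q)
       - word (p @ [Loop (bracket u v) (n + m)] @ q)
       - (if n + m = 0 then free_scale (of_int n * B u v) (word (p @ [Central] @ q)) else 0)
       \<in> affine_relators sc bracket B"
| central:
    "word (p @ [Central, Loop u n] @ q) - word (p @ [Loop u n, Central] @ q)
       \<in> affine_relators sc bracket B"
| annihilate: "n \<ge> 0 \<Longrightarrow> word (p @ [Loop u n]) \<in> affine_relators sc bracket B"
| level_one: "word (p @ [Central]) - word p \<in> affine_relators sc bracket B"

fun letter_action :: "'w vertex_alg \<Rightarrow> ('g \<Rightarrow> 'w) \<Rightarrow> 'g affine_letter \<Rightarrow> 'w \<Rightarrow> 'w" where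
  "letter_action W J (Loop u n) = nprod W (J u) n"
| "letter_action W J Central = id"

definition free_action ::
    "'w::ab_group_add vertex_alg \<Rightarrow> ('g \<Rightarrow> 'w) \<Rightarrow> 'g free_alg \<Rightarrow> 'w" where
  "free_action W J p =
     (\<Sum>ls\<in>Poly_Mapping.keys p.
        vscale W (Poly_Mapping.lookup p ls) (foldr (letter_action W J) ls (vacuum W)))"

text \<open>
  The predicate says that \<open>W\<close> is a copy of \<open>\<O>(\<g>, B)\<close> with generating fields \<open>J u\<close>; it determines
  the pair of \<open>W\<close> and \<open>J\<close> up to a unique isomorphism. The last two axioms say that \<open>W\<close> is the induced
  module \<open>N(\<g>, B)\<close>, with the vacuum as its canonical generator.
\<close>

locale universal_affine = vertex_algebra W + invariant_form sc bracket B
  for W :: "'w::ab_group_add vertex_alg"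
    and sc :: "complex \<Rightarrow> 'g::ab_group_add \<Rightarrow> 'g"
    and bracket :: "'g \<Rightarrow> 'g \<Rightarrow> 'g" and B :: "'g \<Rightarrow> 'g \<Rightarrow> complex" +
  fixes J :: "'g \<Rightarrow> 'w"
  assumes current_linear: "Vector_Spaces.linear sc (vscale W) J"
    and current_ope: "n \<ge> 0 \<Longrightarrow> nprod W (J u) n (J v) =
      (if n = 0 then J (bracket u v) else if n = 1 then vscale W (B u v) (vacuum W) else 0)"
    and induced_surj: "surj (free_action W J)"
    and induced_kernel: "free_action W J p = 0 \<longleftrightarrow>
      p \<in> module.span free_scale (affine_relators sc bracket B)"


section \<open>The beta-gamma system\<close>

text \<open>
  The creation operators relative to a basis of \<open>V\<close> and its dual basis: the index \<open>(Inl b, k)\<close>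
  stands for \<open>\<beta>\<^sup>b(-k-1)\<close>, and \<open>(Inr b, k)\<close> for \<open>\<gamma>\<^bsup>b'\<^esup>(-k-1)\<close>. By the OPEs they commute, so
  \<open>fock_monomial\<close> does not depend on an order of the factors.
\<close>

fun creation_mode ::
    "'w vertex_alg \<Rightarrow> (complex \<Rightarrow> 'v::ab_group_add \<Rightarrow> 'v) \<Rightarrow> 'v set \<Rightarrow>
     ('v \<Rightarrow> 'w) \<Rightarrow> (('v \<Rightarrow> complex) \<Rightarrow> 'w) \<Rightarrow> ('v + 'v) \<times> nat \<Rightarrow> 'w \<Rightarrow> 'w" where
  "creation_mode W sc bs \<beta> \<gamma> (Inl b, k) = nprod W (\<beta> b) (- int k - 1)"
| "creation_mode W sc bs \<beta> \<gamma> (Inr b, k) = nprod W (\<gamma> (dual_vec sc bs b)) (- int k - 1)"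

definition fock_monomial ::
    "'w vertex_alg \<Rightarrow> (complex \<Rightarrow> 'v::ab_group_add \<Rightarrow> 'v) \<Rightarrow> 'v set \<Rightarrow>
     ('v \<Rightarrow> 'w) \<Rightarrow> (('v \<Rightarrow> complex) \<Rightarrow> 'w) \<Rightarrow> (('v + 'v) \<times> nat) multiset \<Rightarrow> 'w" where
  "fock_monomial W sc bs \<beta> \<gamma> M =
     fold_mset (creation_mode W sc bs \<beta> \<gamma>) (vacuum W) M"

definition fock_indices :: "'v set \<Rightarrow> (('v + 'v) \<times> nat) multiset set" where
  "fock_indices bs = {M. set_mset M \<subseteq> (bs <+> bs) \<times> UNIV}"

text \<open>
  The predicate says that \<open>W\<close> is a copy of \<open>\<S>(V)\<close> with generating fields \<open>\<beta> x\<close>, \<open>\<gamma> \<phi>\<close>; it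
  determines \<open>W\<close>, \<open>\<beta>\<close> and \<open>\<gamma>\<close> up to a unique isomorphism. Values of \<open>\<gamma>\<close> outside the dual space are
  irrelevant. The last three axioms are the PBW basis of the Fock module.
\<close>

locale beta_gamma_system = vertex_algebra W + V: finite_dimensional_vector_space sc bs
  for W :: "'w::ab_group_add vertex_alg"
    and sc :: "complex \<Rightarrow> 'v::ab_group_add \<Rightarrow> 'v" and bs :: "'v set" +
  fixes \<beta> :: "'v \<Rightarrow> 'w" and \<gamma> :: "('v \<Rightarrow> complex) \<Rightarrow> 'w"
  assumes beta_linear: "Vector_Spaces.linear sc (vscale W) \<beta>"
    and gamma_linear: "\<phi> \<in> dual_space sc \<Longrightarrow> \<eta> \<in> dual_space sc \<Longrightarrow>
      \<gamma> (\<lambda>x. a * \<phi> x + c * \<eta> x) = vscale W a (\<gamma> \<phi>) + vscale W c (\<gamma> \<eta>)"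
    and beta_gamma_ope: "\<phi> \<in> dual_space sc \<Longrightarrow> n \<ge> 0 \<Longrightarrow>
      nprod W (\<beta> x) n (\<gamma> \<phi>) = (if n = 0 then vscale W (\<phi> x) (vacuum W) else 0)"
    and beta_beta_ope: "n \<ge> 0 \<Longrightarrow> nprod W (\<beta> x) n (\<beta> y) = 0"
    and gamma_gamma_ope: "\<phi> \<in> dual_space sc \<Longrightarrow> \<eta> \<in> dual_space sc \<Longrightarrow> n \<ge> 0 \<Longrightarrow>
      nprod W (\<gamma> \<phi>) n (\<gamma> \<eta>) = 0"
    and fock_inj: "inj_on (fock_monomial W sc bs \<beta> \<gamma>) (fock_indices bs)"
    and fock_independent:
      "\<not> module.dependent (vscale W) (fock_monomial W sc bs \<beta> \<gamma> ` fock_indices bs)"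
    and fock_span:
      "module.span (vscale W) (fock_monomial W sc bs \<beta> \<gamma> ` fock_indices bs) = UNIV"

text \<open>The image of \<open>u\<close> under \<open>\<rho>\<close>-hat; it does not depend on the basis \<open>bs\<close>.\<close>

definition rep_current ::
    "'w::ab_group_add vertex_alg \<Rightarrow> (complex \<Rightarrow> 'v::ab_group_add \<Rightarrow> 'v) \<Rightarrow> 'v set \<Rightarrow>
     ('v \<Rightarrow> 'w) \<Rightarrow> (('v \<Rightarrow> complex) \<Rightarrow> 'w) \<Rightarrow> ('g \<Rightarrow> 'v \<Rightarrow> 'v) \<Rightarrow> 'g \<Rightarrow> 'w" where
  "rep_current W sc bs \<beta> \<gamma> \<rho> u =
     - (\<Sum>b\<in>bs. wick W (\<beta> (\<rho> u b)) (\<gamma> (dual_vec sc bs b)))"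


section \<open>The Lie algebra of traceless complex 2 by 2 matrices\<close>

typedef sl2 = "{A :: complex^2^2. trace A = 0}"
  by (rule exI[of _ 0]) (simp add: trace_def)

setup_lifting type_definition_sl2

instantiation sl2 :: ab_group_add
begin

lift_definition zero_sl2 :: sl2 is 0
  by (simp add: trace_def)

lift_definition plus_sl2 :: "sl2 \<Rightarrow> sl2 \<Rightarrow> sl2" is "(+)"
  by (simp add: trace_add)

lift_definition minus_sl2 :: "sl2 \<Rightarrow> sl2 \<Rightarrow> sl2" is "(-)"
  by (simp add: trace_sub)

lift_definition uminus_sl2 :: "sl2 \<Rightarrow> sl2" is uminus
  by (simp add: trace_def sum_2 neg_eq_iff_add_eq_0)

instance
  by standard (transfer; simp)+

end

lift_definition sl2_scale :: "complex \<Rightarrow> sl2 \<Rightarrow> sl2" is "\<lambda>c A. \<chi> i j. c * A $ i $ j"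
  by (simp add: trace_def sum_2 flip: distrib_left)

lift_definition sl2_bracket :: "sl2 \<Rightarrow> sl2 \<Rightarrow> sl2" is "\<lambda>A B. A ** B - B ** A"
  by (simp only: trace_sub) (metis diff_self trace_mul_sym)

lift_definition sl2_e :: sl2 is "vector [vector [0, 1], vector [0, 0]]"
  by (simp add: trace_def sum_2)

lift_definition sl2_f :: sl2 is "vector [vector [0, 0], vector [1, 0]]"
  by (simp add: trace_def sum_2)

lift_definition sl2_h :: sl2 is "vector [vector [1, 0], vector [0, -1]]"
  by (simp add: trace_def sum_2)

definition sl2_basis :: "sl2 set" where
  "sl2_basis = {sl2_e, sl2_f, sl2_h}"

abbreviation sl2_dual :: "sl2 \<Rightarrow> sl2 \<Rightarrow> complex" where
  "sl2_dual \<equiv> dual_vec sl2_scale sl2_basis"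

abbreviation sl2_killing :: "sl2 \<Rightarrow> sl2 \<Rightarrow> complex" where
  "sl2_killing \<equiv> killing_form sl2_scale sl2_basis sl2_bracket"

lemma Rep_sl2_22: "Rep_sl2 X $ 2 $ 2 = - Rep_sl2 X $ 1 $ 1"
  using Rep_sl2[of X] by (simp add: trace_def sum_2 add_eq_0_iff)

lemma sl2_eq_iff:
  "A = B \<longleftrightarrow> Rep_sl2 A $ 1 $ 1 = Rep_sl2 B $ 1 $ 1 \<and> Rep_sl2 A $ 1 $ 2 = Rep_sl2 B $ 1 $ 2 \<and>
     Rep_sl2 A $ 2 $ 1 = Rep_sl2 B $ 2 $ 1"
  by (auto simp: Rep_sl2_inject[symmetric] vec_eq_iff forall_2 Rep_sl2_22)

lemmas sl2_rep_simps =
  zero_sl2.rep_eq plus_sl2.rep_eq minus_sl2.rep_eq uminus_sl2.rep_eq sl2_scale.rep_eq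
  sl2_bracket.rep_eq sl2_e.rep_eq sl2_f.rep_eq sl2_h.rep_eq Rep_sl2_22
  matrix_matrix_mult_def sum_2

lemma sl2_brackets:
  "sl2_bracket sl2_e sl2_f = sl2_h"
  "sl2_bracket sl2_h sl2_e = sl2_scale 2 sl2_e"
  "sl2_bracket sl2_h sl2_f = sl2_scale (-2) sl2_f"
  by (auto simp: sl2_eq_iff sl2_rep_simps)

interpretation sl2: vector_space sl2_scale
  by unfold_locales (auto simp: sl2_eq_iff sl2_rep_simps algebra_simps)

lemma linear_sl2I:
  assumes "\<And>x y. f (x + y) = f x + f y" "\<And>c x. f (sl2_scale c x) = sl2_scale c (f x)"
  shows "Vector_Spaces.linear sl2_scale sl2_scale f"
  using assms by unfold_locales auto

lemma linear_sl2_formI: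
  assumes "\<And>x y. f (x + y) = f x + f y" "\<And>c x. f (sl2_scale c x) = c * f x"
  shows "Vector_Spaces.linear sl2_scale (*) f"
  using assms by unfold_locales (auto simp: algebra_simps)

lemma lie_algebra_sl2: "lie_algebra sl2_scale sl2_bracket"
  by unfold_locales (auto simp: sl2_eq_iff sl2_rep_simps algebra_simps)

lemma sl2_basis_distinct: "sl2_e \<noteq> sl2_f" "sl2_e \<noteq> sl2_h" "sl2_f \<noteq> sl2_h"
  by (auto simp: sl2_eq_iff sl2_rep_simps)

lemma sl2_expand:
  "sl2_scale (Rep_sl2 A $ 1 $ 2) sl2_e + sl2_scale (Rep_sl2 A $ 2 $ 1) sl2_f +
   sl2_scale (Rep_sl2 A $ 1 $ 1) sl2_h = A"
  by (auto simp: sl2_eq_iff sl2_rep_simps)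

interpretation sl2: finite_dimensional_vector_space sl2_scale sl2_basis
proof
  show "finite sl2_basis" by (simp add: sl2_basis_def)
  show "sl2.independent sl2_basis"
  proof (rule sl2.independent_if_scalars_zero)
    fix f x
    assume *: "(\<Sum>x\<in>sl2_basis. sl2_scale (f x) x) = 0" and x: "x \<in> sl2_basis"
    from * have "sl2_scale (f sl2_e) sl2_e + sl2_scale (f sl2_f) sl2_f +
        sl2_scale (f sl2_h) sl2_h = 0"
      using sl2_basis_distinct by (simp add: sl2_basis_def add.assoc)
    then have "f sl2_e = 0 \<and> f sl2_f = 0 \<and> f sl2_h = 0"
      by (simp add: sl2_eq_iff sl2_rep_simps)
    with x show "f x = 0"
      by (auto simp: sl2_basis_def)
  qed (simp add: sl2_basis_def)
  show "sl2.span sl2_basis = UNIV"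
  proof -
    have "A \<in> sl2.span sl2_basis" for A
      by (subst sl2_expand[symmetric])
        (intro sl2.span_add sl2.span_scale sl2.span_base; simp add: sl2_basis_def)
    then show ?thesis by auto
  qed
qed

lemma sl2_dual_eq:
  "sl2_dual sl2_e = (\<lambda>A. Rep_sl2 A $ 1 $ 2)"
  "sl2_dual sl2_f = (\<lambda>A. Rep_sl2 A $ 2 $ 1)"
  "sl2_dual sl2_h = (\<lambda>A. Rep_sl2 A $ 1 $ 1)"
proof -
  have "sl2.representation sl2_basis A =
      (\<lambda>b. if b = sl2_e then Rep_sl2 A $ 1 $ 2 else if b = sl2_f then Rep_sl2 A $ 2 $ 1
           else if b = sl2_h then Rep_sl2 A $ 1 $ 1 else 0)" (is "_ = ?r") for A
  proof (rule sl2.representation_eqI)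
    have fin: "{b. ?r b \<noteq> 0} \<subseteq> sl2_basis" by (auto simp: sl2_basis_def)
    then show "finite {b. ?r b \<noteq> 0}"
      using finite_subset sl2.finite_Basis by blast
    have "(\<Sum>b | ?r b \<noteq> 0. sl2_scale (?r b) b) = (\<Sum>b\<in>sl2_basis. sl2_scale (?r b) b)"
      by (rule sum.mono_neutral_left) (use fin sl2.finite_Basis in auto)
    also have "\<dots> = A"
      using sl2_basis_distinct sl2_expand[of A]
      by (auto simp: sl2_basis_def add.assoc)
    finally show "(\<Sum>b | ?r b \<noteq> 0. sl2_scale (?r b) b) = A" .
    show "sl2.independent sl2_basis" by (rule sl2.independent_Basis)
    show "A \<in> sl2.span sl2_basis" by (simp add: sl2.span_Basis)
  qed (auto simp: sl2_basis_def split: if_splits)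
  then show
    "sl2_dual sl2_e = (\<lambda>A. Rep_sl2 A $ 1 $ 2)"
    "sl2_dual sl2_f = (\<lambda>A. Rep_sl2 A $ 2 $ 1)"
    "sl2_dual sl2_h = (\<lambda>A. Rep_sl2 A $ 1 $ 1)"
    using sl2_basis_distinct by (auto simp: dual_vec_def fun_eq_iff)
qed

lemma sl2_killing_eq:
  "sl2_killing A B = 8 * (Rep_sl2 A $ 1 $ 1 * Rep_sl2 B $ 1 $ 1)
     + 4 * (Rep_sl2 A $ 1 $ 2 * Rep_sl2 B $ 2 $ 1) + 4 * (Rep_sl2 A $ 2 $ 1 * Rep_sl2 B $ 1 $ 2)"
  using sl2_basis_distinct
  by (simp add: killing_form_def endo_trace_def sl2_basis_def[THEN arg_cong[where f = "sum _"]]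
      sl2_dual_eq sl2_rep_simps algebra_simps)

lemma invariant_form_sl2_killing:
  "invariant_form sl2_scale sl2_bracket (\<lambda>u v. c * sl2_killing u v)"
proof -
  interpret lie_algebra sl2_scale sl2_bracket by (rule lie_algebra_sl2)
  show ?thesis
    by unfold_locales (auto simp: sl2_killing_eq sl2_rep_simps algebra_simps)
qed

end

theory Submission
  imports Defs "HOL-Computational_Algebra.Formal_Power_Series" "HOL-Computational_Algebra.Polynomial"
begin

text \<open>
  Filter \<open>\<S>(V)\<close> by the degree of Fock monomials. The associated graded space is the ring of polynomial
  functions on the arc space of \<open>V \<oplus> V\<^sup>*\<close>, and the leading part of a vector of the commutant is invariant
  under \<open>sl\<^sub>2[[t]]\<close>: the non-negative modes of \<open>\<Theta>\<close> act on leading parts by the vector fields of that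
  Lie algebra. Such an invariant is a polynomial in the coefficients of the three quadratic
  invariants \<open>A\<close>, \<open>B\<close>, \<open>D\<close> of a pair of vectors. Indeed, a generic arc can be moved by the unipotent flows
  and the torus flow to a normal form that depends only on \<open>B\<close>, \<open>D\<close> and a square root of \<open>A\<close>; as both
  square roots are admissible, the invariant is a polynomial in the coefficients of \<open>A\<close>, \<open>B\<close>, \<open>D\<close>
  divided by a power of the constant term of \<open>A\<close>, and the denominator cancels because \<open>(A, B, D)\<close>
  maps the arcs onto a dense part of the hypersurface where that constant term vanishes. Since the quadratic
  invariants are the leading parts of \<open>v\<^sup>f\<close>, \<open>v\<^sup>h\<close>, \<open>v\<^sup>e\<close>, subtracting a combination of normally ordered
  monomials lowers the degree of a vector of the commutant.
\<close>

section \<open>Polynomial invariants of pairs of arcs\<close>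

text \<open>The group of arcs in SL2 is not reductive, so invariants cannot be found by averaging;
  the explicit normal form takes the place of that argument. It is computed over power series, where
  dividing by a series only requires a nonzero constant term, so genericity is a condition on
  finitely many constant terms. Polynomials in the infinitely many arc coordinates are treated as
  functions, and identities between them are tested on lines, where they become identities of
  one-variable polynomials. Annihilation by modes is turned into invariance under finite flows by
  differentiating along curves of arcs, with a complex time parameter. The constants come from the
  Killing form: \<open>K(h,h) = 8\<close> and \<open>K(e,f) = 4\<close>. In terms of an orthonormal
  basis, the sum of the squares of the beta fields is \<open>1/8\<close> of the form
  \<open>QF\<close> below and that of the gamma fields is \<open>8\<close> times \<open>QE\<close>;
  the factors \<open>-1/2\<close> and \<open>1/2\<close> in the current generators then produce
  \<open>-1/16\<close> and \<open>4\<close>.\<close>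

inductive_set fun_alg :: "('x \<Rightarrow> complex) set \<Rightarrow> ('x \<Rightarrow> complex) set" for G where
  const: "(\<lambda>_. c) \<in> fun_alg G"
| gen: "g \<in> G \<Longrightarrow> g \<in> fun_alg G"
| add: "f \<in> fun_alg G \<Longrightarrow> g \<in> fun_alg G \<Longrightarrow> (\<lambda>x. f x + g x) \<in> fun_alg G"
| mult: "f \<in> fun_alg G \<Longrightarrow> g \<in> fun_alg G \<Longrightarrow> (\<lambda>x. f x * g x) \<in> fun_alg G"

lemma fun_alg_minus: "f \<in> fun_alg G \<Longrightarrow> (\<lambda>x. - f x) \<in> fun_alg G"
  using fun_alg.mult[OF fun_alg.const[of "-1"]] by simp

lemma fun_alg_diff: "f \<in> fun_alg G \<Longrightarrow> g \<in> fun_alg G \<Longrightarrow> (\<lambda>x. f x - g x) \<in> fun_alg G"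
  using fun_alg.add[OF _ fun_alg_minus] by fastforce

lemma fun_alg_power: "f \<in> fun_alg G \<Longrightarrow> (\<lambda>x. f x ^ n) \<in> fun_alg G"
  by (induction n) (auto intro: fun_alg.intros)

lemma fun_alg_sum: "(\<And>i. i \<in> A \<Longrightarrow> f i \<in> fun_alg G) \<Longrightarrow> (\<lambda>x. \<Sum>i\<in>A. f i x) \<in> fun_alg G"
  by (induction A rule: infinite_finite_induct) (auto intro: fun_alg.intros)

lemma fun_alg_compose:
  assumes "f \<in> fun_alg G" and "\<And>g. g \<in> G \<Longrightarrow> (\<lambda>x. g (h x)) \<in> fun_alg G'"
  shows "(\<lambda>x. f (h x)) \<in> fun_alg G'"
  using assms(1) by induction (auto intro: fun_alg.intros assms(2))

lemma fun_alg_mono: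
  assumes "f \<in> fun_alg G" "G \<subseteq> G'"
  shows "f \<in> fun_alg G'"
  using fun_alg_compose[OF assms(1), of "\<lambda>x. x" G'] assms(2) by (auto intro: fun_alg.intros)

definition fps_alg :: "('x \<Rightarrow> complex) set \<Rightarrow> ('x \<Rightarrow> complex fps) set" where
  "fps_alg G = {a. \<forall>k. (\<lambda>x. fps_nth (a x) k) \<in> fun_alg G}"

lemma fps_algD: "a \<in> fps_alg G \<Longrightarrow> (\<lambda>x. fps_nth (a x) k) \<in> fun_alg G"
  by (simp add: fps_alg_def)

lemma fps_alg_const: "(\<lambda>_. a) \<in> fps_alg G"
  by (auto simp: fps_alg_def intro: fun_alg.intros)

lemma fps_alg_fps_const: "f \<in> fun_alg G \<Longrightarrow> (\<lambda>x. fps_const (f x)) \<in> fps_alg G"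
  unfolding fps_alg_def mem_Collect_eq
proof
  fix k assume "f \<in> fun_alg G"
  then show "(\<lambda>x. fps_nth (fps_const (f x)) k) \<in> fun_alg G"
    by (cases "k = 0") (auto intro: fun_alg.const)
qed

lemma fps_alg_add: "a \<in> fps_alg G \<Longrightarrow> b \<in> fps_alg G \<Longrightarrow> (\<lambda>x. a x + b x) \<in> fps_alg G"
  by (auto simp: fps_alg_def intro: fun_alg.intros)

lemma fps_alg_diff: "a \<in> fps_alg G \<Longrightarrow> b \<in> fps_alg G \<Longrightarrow> (\<lambda>x. a x - b x) \<in> fps_alg G"
  by (auto simp: fps_alg_def intro: fun_alg_diff)

lemma fps_alg_mult: "a \<in> fps_alg G \<Longrightarrow> b \<in> fps_alg G \<Longrightarrow> (\<lambda>x. a x * b x) \<in> fps_alg G"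
  by (auto simp: fps_alg_def fps_mult_nth intro!: fun_alg.mult fun_alg_sum)

lemma fps_alg_power: "a \<in> fps_alg G \<Longrightarrow> (\<lambda>x. a x ^ n) \<in> fps_alg G"
  by (induction n) (auto intro: fps_alg_mult fps_alg_const)

text \<open>The coefficients of the inverse obey a recursion that divides by the constant term
  alone, so one reciprocal suffices. With the convention \<open>inverse 0 = 0\<close> the recursion
  also holds at points where the constant term vanishes.\<close>

lemma fps_alg_inverse:
  assumes "a \<in> fps_alg G" and inv: "(\<lambda>x. inverse (fps_nth (a x) 0)) \<in> fun_alg G"
  shows "(\<lambda>x. inverse (a x)) \<in> fps_alg G"
proof -
  have "(\<lambda>x. fps_nth (inverse (a x)) k) \<in> fun_alg G" for k
  proof (induction k rule: less_induct)
    case (less k)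
    show ?case
    proof (cases k)
      case 0
      then show ?thesis using inv by simp
    next
      case (Suc m)
      have eq: "fps_nth (inverse (a x)) k = - inverse (fps_nth (a x) 0)
          * (\<Sum>i=1..k. fps_nth (a x) i * fps_nth (inverse (a x)) (k - i))" for x
        using Suc by (simp add: fps_inverse_def)
      show ?thesis
        unfolding eq
        by (intro fun_alg.mult fun_alg_minus inv fun_alg_sum fps_algD assms(1) less) auto
    qed
  qed
  then show ?thesis by (simp add: fps_alg_def)
qed

section \<open>Polynomial functions on arc spaces and density of principal open sets\<close>

definition coords :: "(('i \<Rightarrow> complex fps) \<Rightarrow> complex) set" where
  "coords = {\<lambda>p. fps_nth (p i) k | i k. True}"

lemma coord_in: "(\<lambda>p. fps_nth (p i) k) \<in> fun_alg coords"
  by (rule fun_alg.gen) (auto simp: coords_def)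

lemma fps_alg_coord: "coords \<subseteq> G \<Longrightarrow> (\<lambda>p. p i) \<in> fps_alg G"
  by (auto simp: fps_alg_def intro!: fun_alg.gen) (auto simp: coords_def)

lemma fun_alg_coords_compose:
  assumes "f \<in> fun_alg coords" and "\<And>i. (\<lambda>x. h x i) \<in> fps_alg G"
  shows "(\<lambda>x. f (h x)) \<in> fun_alg G"
  by (rule fun_alg_compose[OF assms(1)]) (use assms(2) in \<open>auto simp: coords_def intro: fps_algD\<close>)

lemma fun_alg_coords_line:
  assumes "f \<in> fun_alg coords"
  obtains P where "\<And>s. f (\<lambda>i. p i + fps_const s * d i) = poly P s"
proof -
  have "\<exists>P. \<forall>s. f (\<lambda>i. p i + fps_const s * d i) = poly P s"
    using assms
  proof induction
    case (const c)
    show ?case by (rule exI[of _ "[:c:]"]) simp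
  next
    case (gen g)
    then obtain i k where "g = (\<lambda>p. fps_nth (p i) k)" by (auto simp: coords_def)
    then show ?case by (intro exI[of _ "[:fps_nth (p i) k, fps_nth (d i) k:]"]) simp
  next
    case (add f g)
    then show ?case by (metis poly_add)
  next
    case (mult f g)
    then show ?case by (metis poly_mult)
  qed
  then show ?thesis using that by blast
qed

text \<open>On the line from \<open>p\<close> to \<open>q\<close> the two functions become
  one-variable polynomials with product zero, and the one coming from \<open>g\<close> is nonzero
  because of its value at \<open>q\<close>. This is the density of a nonempty principal open set:
  polynomial identities may be checked at generic points.\<close>

lemma fun_alg_coords_zero_product:
  fixes f g :: "('i \<Rightarrow> complex fps) \<Rightarrow> complex"
  assumes "f \<in> fun_alg coords" "g \<in> fun_alg coords"
    and prod: "\<And>p. g p \<noteq> 0 \<Longrightarrow> f p = 0" and q: "g q \<noteq> 0"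
  shows "f p = 0"
proof -
  let ?l = "\<lambda>s i. p i + fps_const s * (q i - p i)"
  obtain P where P: "\<And>s. f (?l s) = poly P s"
    by (rule fun_alg_coords_line[OF assms(1), of p "\<lambda>i. q i - p i"]) blast
  obtain Q where Q: "\<And>s. g (?l s) = poly Q s"
    by (rule fun_alg_coords_line[OF assms(2), of p "\<lambda>i. q i - p i"]) blast
  have "poly (P * Q) s = 0" for s
    using prod[of "?l s"] P[of s] Q[of s] by auto
  then have "P * Q = 0" using poly_all_0_iff_0 by blast
  moreover have "poly Q 1 \<noteq> 0" using Q[of 1] q by simp
  ultimately have "P = 0" by auto
  then show ?thesis using P[of 0] by simp
qed

lemma fps_sqrt_exists:
  fixes a :: "complex fps"
  assumes "fps_nth a 0 \<noteq> 0"
  obtains r where "r ^ 2 = a"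
proof
  show "fps_radical (\<lambda>_. csqrt) 2 a ^ 2 = a"
    using iffD1[OF power_radical[OF assms, of "\<lambda>_. csqrt" 1]] by (simp only: Suc_1 power2_csqrt)
qed

lemma fps_mult_inverse: "fps_nth (a :: complex fps) 0 \<noteq> 0 \<Longrightarrow> a * inverse a = 1"
  by (simp add: inverse_mult_eq_1')

text \<open>
  The indices stand for the fields \<open>\<beta>\<^sup>e\<close>, \<open>\<beta>\<^sup>f\<close>, \<open>\<beta>\<^sup>h\<close>, \<open>\<gamma>\<^bsup>e'\<^esup>\<close>, \<open>\<gamma>\<^bsup>f'\<^esup>\<close>, \<open>\<gamma>\<^bsup>h'\<^esup>\<close>. A point \<open>p\<close> of the arc space has power series
  as coordinates; the coefficient of \<open>t\<^sup>k\<close> corresponds to the mode \<open>-k-1\<close>.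
\<close>

datatype gen = Xe | Xf | Xh | Ye | Yf | Yh

primrec pt :: "'c \<Rightarrow> 'c \<Rightarrow> 'c \<Rightarrow> 'c \<Rightarrow> 'c \<Rightarrow> 'c \<Rightarrow> gen \<Rightarrow> 'c" where
  "pt xe xf xh ye yf yh Xe = xe"
| "pt xe xf xh ye yf yh Xf = xf"
| "pt xe xf xh ye yf yh Xh = xh"
| "pt xe xf xh ye yf yh Ye = ye"
| "pt xe xf xh ye yf yh Yf = yf"
| "pt xe xf xh ye yf yh Yh = yh"

lemma pt_eta: "pt (p Xe) (p Xf) (p Xh) (p Ye) (p Yf) (p Yh) = p"
  by (rule ext) (case_tac x; simp)

section \<open>Quadratic invariants, flows and the normal form of a generic arc\<close>

datatype quad = QF | QE | QH

primrec quads :: "(gen \<Rightarrow> 'c::comm_ring_1) \<Rightarrow> quad \<Rightarrow> 'c" where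
  "quads p QF = p Xh ^ 2 + 4 * p Xe * p Xf"
| "quads p QE = p Yh ^ 2 + p Ye * p Yf"
| "quads p QH = p Xh * p Yh + p Xe * p Ye + p Xf * p Yf"

text \<open>
  The actions of \<open>exp (c e)\<close> and \<open>exp (c f)\<close>, and of the torus element scaling \<open>e\<close> by \<open>l\<close>, on arcs in
  \<open>V \<oplus> V\<^sup>*\<close>.
\<close>

definition flow_e :: "'c::comm_ring_1 \<Rightarrow> (gen \<Rightarrow> 'c) \<Rightarrow> gen \<Rightarrow> 'c" where
  "flow_e c p = pt (p Xe) (p Xf + c * p Xh - c^2 * p Xe) (p Xh - 2 * c * p Xe)
     (p Ye + 2 * c * p Yh - c^2 * p Yf) (p Yf) (p Yh - c * p Yf)"

definition flow_f :: "'c::comm_ring_1 \<Rightarrow> (gen \<Rightarrow> 'c) \<Rightarrow> gen \<Rightarrow> 'c" where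
  "flow_f c p = pt (p Xe - c * p Xh - c^2 * p Xf) (p Xf) (p Xh + 2 * c * p Xf)
     (p Ye) (p Yf - 2 * c * p Yh - c^2 * p Ye) (p Yh + c * p Ye)"

definition flow_h :: "complex fps \<Rightarrow> (gen \<Rightarrow> complex fps) \<Rightarrow> gen \<Rightarrow> complex fps" where
  "flow_h l p = pt (l * p Xe) (inverse l * p Xf) (p Xh) (inverse l * p Ye) (l * p Yf) (p Yh)"

lemma quads_flow_e: "quads (flow_e c p) j = quads p j"
  by (cases j) (simp_all add: flow_e_def algebra_simps power2_eq_square)

lemma quads_flow_f: "quads (flow_f c p) j = quads p j"
  by (cases j) (simp_all add: flow_f_def algebra_simps power2_eq_square)

text \<open>The slot \<open>QF\<close> of the argument holds a square root of the invariant, not the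
  invariant itself. Once \<open>Xe = Xf = 0\<close> and \<open>Ye = 1\<close>, the values of
  \<open>Yh\<close> and \<open>Yf\<close> are forced by the invariants \<open>QH\<close> and
  \<open>QE\<close>.\<close>

definition normal_pt :: "(quad \<Rightarrow> complex fps) \<Rightarrow> gen \<Rightarrow> complex fps" where
  "normal_pt r = pt 0 0 (r QF) 1 (r QE - (r QH * inverse (r QF)) ^ 2) (r QH * inverse (r QF))"

locale flow_invariant =
  fixes F :: "(gen \<Rightarrow> complex fps) \<Rightarrow> complex"
  assumes polynomial: "F \<in> fun_alg coords"
    and inv_e: "F (flow_e c p) = F p"
    and inv_f: "F (flow_f c p) = F p"
    and inv_h: "fps_nth l 0 \<noteq> 0 \<Longrightarrow> F (flow_h l p) = F p"
begin

text \<open>The flows of \<open>e\<close> and \<open>f\<close> move the first vector to a multiple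
  of \<open>h\<close>; the torus fixes this multiple and is used to normalise \<open>Ye\<close>. The
  assumptions turn the three divisors \<open>u\<close>, \<open>r\<close> and \<open>p2 Ye\<close>
  into units.\<close>

lemma normal_form:
  assumes g1: "fps_nth (p Xe) 0 \<noteq> 0" "fps_nth (p Xf) 0 \<noteq> 0"
    and g2: "fps_nth (quads p QF) 0 \<noteq> 0"
    and g3: "fps_nth (quads p QF * quads p QE - quads p QH ^ 2) 0 \<noteq> 0"
    and r: "r ^ 2 = quads p QF"
  shows "F p = F (normal_pt ((quads p)(QF := r)))"
proof -
  define u where "u = p Xh + r"
  have r': "r * r = p Xh * p Xh + 4 * p Xe * p Xf"
    using r by (simp add: power2_eq_square)
  have r0: "fps_nth r 0 \<noteq> 0"
    using g2 unfolding r[symmetric] by (auto simp: power2_eq_square)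
  have "u * (r - p Xh) = 4 * p Xe * p Xf"
    using r' by (simp add: u_def algebra_simps)
  then have "fps_nth (u * (r - p Xh)) 0 \<noteq> 0"
    using g1 by (simp add: numeral_fps_const)
  then have "fps_nth u 0 \<noteq> 0" by auto
  then have uu: "u * inverse u = 1" by (rule fps_mult_inverse)
  have rr: "r * inverse r = 1" using r0 by (rule fps_mult_inverse)
  \<comment> \<open>A root of \<open>p Xf + c * p Xh - c^2 * p Xe = 0\<close>, so that the flow
    kills the \<open>Xf\<close> coordinate. It is \<open>(p Xh - r) / (2 * p Xe)\<close>, rewritten
    with the denominator \<open>u\<close>.\<close>
  define c where "c = - 2 * p Xf * inverse u"
  define p1 where "p1 = flow_e c p"
  have cu: "c * u = - 2 * p Xf" using uu by (simp add: c_def mult.assoc mult.commute[of _ u])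
  have "u * u * (p Xf + c * p Xh - c^2 * p Xe) = p Xf * (u * u) + (c * u) * u * p Xh - (c * u)^2 * p Xe"
    by (simp add: algebra_simps power2_eq_square)
  also have "\<dots> = p Xf * (r * r - p Xh * p Xh - 4 * p Xe * p Xf)"
    unfolding cu by (simp add: u_def algebra_simps power2_eq_square)
  also have "\<dots> = 0" using r' by simp
  finally have "u * u * p1 Xf = 0" by (simp add: p1_def flow_e_def)
  moreover have "u \<noteq> 0" using uu by auto
  ultimately have p1Xf: "p1 Xf = 0" by simp
  have "u * (p Xh - 2 * c * p Xe) = u * p Xh - 2 * (c * u) * p Xe"
    by (simp add: algebra_simps)
  also have "\<dots> = u * r" unfolding cu using r' by (simp add: u_def algebra_simps)
  finally have p1Xh: "p1 Xh = r" using \<open>u \<noteq> 0\<close> by (simp add: p1_def flow_e_def)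
  \<comment> \<open>As \<open>p1 Xf = 0\<close>, this flow fixes \<open>Xf\<close> and
    \<open>Xh\<close> and only subtracts \<open>c * r\<close> from \<open>Xe\<close>.\<close>
  define p2 where "p2 = flow_f (p1 Xe * inverse r) p1"
  have p2X: "p2 Xf = 0" "p2 Xh = r" "p2 Xe = 0"
    using p1Xf p1Xh rr by (simp_all add: p2_def flow_f_def mult.assoc mult.commute[of _ r])
  have q: "quads p2 j = quads p j" for j
    by (simp add: p2_def p1_def quads_flow_e quads_flow_f)
  have Yh: "p2 Yh = quads p QH * inverse r"
    unfolding q[of QH, symmetric] using p2X rr by (simp add: mult.assoc mult.commute[of _ r])
  have YeYf: "p2 Ye * p2 Yf = quads p QE - (quads p QH * inverse r) ^ 2"
    unfolding q[of QE, symmetric] Yh[symmetric] by simp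
  \<comment> \<open>The Gram determinant of the pair factors through \<open>p2 Ye\<close>, so its
    nonzero constant term makes \<open>p2 Ye\<close> a unit.\<close>
  have "quads p QF * quads p QE - quads p QH ^ 2 = r ^ 2 * (p2 Ye * p2 Yf)"
    unfolding q[symmetric] using p2X by (simp add: algebra_simps power2_eq_square)
  then have l0: "fps_nth (p2 Ye) 0 \<noteq> 0" using g3 by auto
  then have ll: "p2 Ye * inverse (p2 Ye) = 1" by (rule fps_mult_inverse)
  have "F p = F p2"
    by (simp add: p2_def p1_def inv_e inv_f)
  also have "\<dots> = F (flow_h (p2 Ye) p2)"
    by (rule inv_h[OF l0, symmetric])
  also have "flow_h (p2 Ye) p2 = normal_pt ((quads p)(QF := r))"
    using ll by (simp add: flow_h_def normal_pt_def p2X YeYf Yh mult.commute)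
  finally show ?thesis .
qed

end

section \<open>Elimination of the square root and of the denominators\<close>

abbreviation "loc_coords \<equiv> insert (\<lambda>q. inverse (fps_nth (q QF) 0)) coords"

text \<open>Localisation is modelled by functions: where the constant term of \<open>q QF\<close>
  vanishes, the extra generator has the default value \<open>0\<close>, whence the restriction to
  the open set. The exponents add up in both sums and products.\<close>

lemma loc_coords_clear:
  assumes "f \<in> fun_alg loc_coords"
  shows "\<exists>M. \<exists>P\<in>fun_alg coords. \<forall>q. fps_nth (q QF) 0 \<noteq> 0 \<longrightarrow> f q * fps_nth (q QF) 0 ^ M = P q"
  using assms
proof induction
  case (const c)
  show ?case by (rule exI[of _ 0]) (auto intro!: bexI[OF _ fun_alg.const[of c]])
next
  case (gen g)
  then consider "g = (\<lambda>q. inverse (fps_nth (q QF) 0))" | "g \<in> coords" by blast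
  then show ?case
  proof cases
    case 1
    then show ?thesis by (intro exI[of _ 1] bexI[OF _ fun_alg.const[of 1]]) simp
  next
    case 2
    then show ?thesis by (intro exI[of _ 0] bexI[OF _ fun_alg.gen[OF 2]]) simp
  qed
next
  case (add f g)
  then obtain M P N Q where *: "P \<in> fun_alg coords" "Q \<in> fun_alg coords"
    "\<And>q. fps_nth (q QF) 0 \<noteq> 0 \<Longrightarrow> f q * fps_nth (q QF) 0 ^ M = P q"
    "\<And>q. fps_nth (q QF) 0 \<noteq> 0 \<Longrightarrow> g q * fps_nth (q QF) 0 ^ N = Q q" by metis
  show ?case
    by (intro exI[of _ "M + N"] bexI[of _ "\<lambda>q. P q * fps_nth (q QF) 0 ^ N + Q q * fps_nth (q QF) 0 ^ M"]
          fun_alg.add fun_alg.mult fun_alg_power coord_in *(1,2))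
      (simp add: *(3,4)[symmetric] power_add algebra_simps)
next
  case (mult f g)
  then obtain M P N Q where *: "P \<in> fun_alg coords" "Q \<in> fun_alg coords"
    "\<And>q. fps_nth (q QF) 0 \<noteq> 0 \<Longrightarrow> f q * fps_nth (q QF) 0 ^ M = P q"
    "\<And>q. fps_nth (q QF) 0 \<noteq> 0 \<Longrightarrow> g q * fps_nth (q QF) 0 ^ N = Q q" by metis
  show ?case
    by (intro exI[of _ "M + N"] bexI[of _ "\<lambda>q. P q * Q q"] fun_alg.mult *(1,2))
      (simp add: *(3,4)[symmetric] power_add algebra_simps)
qed

text \<open>Every coefficient of a square root is odd in its constant term: after scaling by that
  term, what remains is the square root of a series with constant term 1, whose coefficients no
  longer depend on the choice of sign.\<close>

lemma sqrt_coeff: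
  "\<exists>\<sigma>\<in>fun_alg loc_coords. \<forall>q. \<forall>r. r ^ 2 = q QF \<longrightarrow> fps_nth r 0 \<noteq> 0 \<longrightarrow>
     fps_nth r k = fps_nth r 0 * \<sigma> q"
proof (induction k rule: less_induct)
  case (less k)
  then obtain \<sigma> where \<sigma>: "\<And>j. j < k \<Longrightarrow> \<sigma> j \<in> fun_alg loc_coords"
    "\<And>j q r. j < k \<Longrightarrow> r ^ 2 = q QF \<Longrightarrow> fps_nth r 0 \<noteq> 0 \<Longrightarrow> fps_nth r j = fps_nth r 0 * \<sigma> j q"
    by metis
  show ?case
  proof (cases k)
    case 0
    then show ?thesis by (intro bexI[OF _ fun_alg.const[of 1]]) simp
  next
    case (Suc m)
    \<comment> \<open>Coefficient \<open>k\<close> of \<open>r * r = q QF\<close>, solved for its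
      two extreme summands, which both equal \<open>fps_nth r 0 * fps_nth r k\<close>.\<close>
    let ?\<sigma> = "\<lambda>q. 1/2 * (fps_nth (q QF) k * inverse (fps_nth (q QF) 0) - (\<Sum>i\<in>{1..<k}. \<sigma> i q * \<sigma> (k - i) q))"
    show ?thesis
    proof (intro bexI[of _ ?\<sigma>] allI impI)
      show "?\<sigma> \<in> fun_alg loc_coords"
        by (intro fun_alg.mult fun_alg.const fun_alg_diff fun_alg_sum \<sigma>
            fun_alg_mono[OF coord_in] fun_alg.gen) auto
      fix q and r :: "complex fps" assume r: "r ^ 2 = q QF" "fps_nth r 0 \<noteq> 0"
      have A0: "fps_nth (q QF) 0 = fps_nth r 0 ^ 2"
        unfolding r(1)[symmetric] by (simp add: power2_eq_square)
      have "fps_nth (q QF) k = (\<Sum>i=0..k. fps_nth r i * fps_nth r (k - i))"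
        unfolding r(1)[symmetric] by (simp add: power2_eq_square fps_mult_nth)
      also have "{0..k} = insert 0 (insert k {1..<k})" using Suc by auto
      also have "(\<Sum>i\<in>insert 0 (insert k {1..<k}). fps_nth r i * fps_nth r (k - i))
          = 2 * fps_nth r 0 * fps_nth r k + (\<Sum>i\<in>{1..<k}. fps_nth r i * fps_nth r (k - i))"
        using Suc by simp
      also have "(\<Sum>i\<in>{1..<k}. fps_nth r i * fps_nth r (k - i))
          = (\<Sum>i\<in>{1..<k}. (fps_nth r 0 * \<sigma> i q) * (fps_nth r 0 * \<sigma> (k - i) q))"
        by (intro sum.cong refl arg_cong2[where f = "(*)"] \<sigma>(2) r) auto
      also have "\<dots> = fps_nth r 0 ^ 2 * (\<Sum>i\<in>{1..<k}. \<sigma> i q * \<sigma> (k - i) q)"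
        by (simp add: sum_distrib_left power2_eq_square algebra_simps)
      finally have "fps_nth (q QF) k = 2 * fps_nth r 0 * fps_nth r k + fps_nth r 0 ^ 2 * (\<Sum>i\<in>{1..<k}. \<sigma> i q * \<sigma> (k - i) q)" .
      then show "fps_nth r k = fps_nth r 0 * ?\<sigma> q"
        using r(2) by (simp add: A0 field_simps power2_eq_square)
    qed
  qed
qed

text \<open>Adjoining the constant term of the root is an extension of degree two, since its square
  is the constant term of \<open>q QF\<close>. Neither \<open>U\<close> nor \<open>V\<close> depends
  on the root, so replacing \<open>r\<close> by \<open>- r\<close> only changes the sign of the
  second part.\<close>

lemma even_odd_decomposition:
  assumes "f \<in> fun_alg loc_coords"
  shows "\<exists>U\<in>fun_alg loc_coords. \<exists>V\<in>fun_alg loc_coords. \<forall>q r. r ^ 2 = q QF \<longrightarrow> fps_nth r 0 \<noteq> 0 \<longrightarrow>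
      f (q(QF := r)) = U q + fps_nth r 0 * V q"
  using assms
proof induction
  case (const c)
  show ?case by (intro bexI[OF _ fun_alg.const[of c]] bexI[OF _ fun_alg.const[of 0]]) simp
next
  case (gen g)
  then consider "g = (\<lambda>q. inverse (fps_nth (q QF) 0))" | k where "g = (\<lambda>q. fps_nth (q QF) k)"
    | i k where "g = (\<lambda>q. fps_nth (q i) k)" "i \<noteq> QF" by (auto simp: coords_def)
  then show ?case
  proof cases
    case 1
    have A0: "fps_nth (q QF) 0 = fps_nth r 0 ^ 2" if "r ^ 2 = q QF" for q :: "quad \<Rightarrow> complex fps" and r
      unfolding that[symmetric] by (simp add: power2_eq_square)
    \<comment> \<open>The reciprocal of \<open>fps_nth r 0\<close> is \<open>fps_nth r 0\<close>
      times the reciprocal of its square.\<close>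
    show ?thesis unfolding 1
      by (intro bexI[OF _ fun_alg.const[of 0]] bexI[OF _ fun_alg.gen[of "\<lambda>q. inverse (fps_nth (q QF) 0)"]])
         (auto simp: A0 power2_eq_square)
  next
    case (2 k)
    obtain \<sigma> where "\<sigma> \<in> fun_alg loc_coords"
      "\<And>q r. r ^ 2 = q QF \<Longrightarrow> fps_nth r 0 \<noteq> 0 \<Longrightarrow> fps_nth r k = fps_nth r 0 * \<sigma> q"
      using sqrt_coeff[of k] by blast
    then show ?thesis unfolding 2
      by (intro bexI[OF _ fun_alg.const[of 0]] bexI[of _ \<sigma>]) auto
  next
    case (3 i k)
    then show ?thesis using gen
      by (intro bexI[OF _ fun_alg.gen[OF gen]] bexI[OF _ fun_alg.const[of 0]]) auto
  qed
next
  case (add f g)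
  from add.IH(1) obtain U V where *: "U \<in> fun_alg loc_coords" "V \<in> fun_alg loc_coords"
    "\<forall>q r. r ^ 2 = q QF \<longrightarrow> fps_nth r 0 \<noteq> 0 \<longrightarrow> f (q(QF := r)) = U q + fps_nth r 0 * V q"
    by blast
  from add.IH(2) obtain U' V' where **: "U' \<in> fun_alg loc_coords" "V' \<in> fun_alg loc_coords"
    "\<forall>q r. r ^ 2 = q QF \<longrightarrow> fps_nth r 0 \<noteq> 0 \<longrightarrow> g (q(QF := r)) = U' q + fps_nth r 0 * V' q"
    by blast
  show ?case
    by (rule bexI[OF _ fun_alg.add[OF *(1) **(1)]], rule bexI[OF _ fun_alg.add[OF *(2) **(2)]],
        intro allI impI, subst *(3)[rule_format], assumption, assumption,
        subst **(3)[rule_format], assumption, assumption)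
      (simp add: algebra_simps)
next
  case (mult f g)
  from mult.IH(1) obtain U V where *: "U \<in> fun_alg loc_coords" "V \<in> fun_alg loc_coords"
    "\<forall>q r. r ^ 2 = q QF \<longrightarrow> fps_nth r 0 \<noteq> 0 \<longrightarrow> f (q(QF := r)) = U q + fps_nth r 0 * V q"
    by blast
  from mult.IH(2) obtain U' V' where **: "U' \<in> fun_alg loc_coords" "V' \<in> fun_alg loc_coords"
    "\<forall>q r. r ^ 2 = q QF \<longrightarrow> fps_nth r 0 \<noteq> 0 \<longrightarrow> g (q(QF := r)) = U' q + fps_nth r 0 * V' q"
    by blast
  have A0: "fps_nth (q QF) 0 = fps_nth r 0 * fps_nth r 0" if "r ^ 2 = q QF" for q :: "quad \<Rightarrow> complex fps" and r
    unfolding that[symmetric] by (simp add: power2_eq_square)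
  have A: "(\<lambda>q. fps_nth (q QF) 0) \<in> fun_alg loc_coords"
    by (rule fun_alg_mono[OF coord_in]) auto
  show ?case
    by (rule bexI[OF _ fun_alg.add[OF fun_alg.mult[OF *(1) **(1)]
            fun_alg.mult[OF A fun_alg.mult[OF *(2) **(2)]]]],
        rule bexI[OF _ fun_alg.add[OF fun_alg.mult[OF *(1) **(2)] fun_alg.mult[OF *(2) **(1)]]],
        intro allI impI, subst *(3)[rule_format], assumption, assumption,
        subst **(3)[rule_format], assumption, assumption)
      (simp add: A0 algebra_simps)
qed

text \<open>Division with remainder by a single variable, the constant term of \<open>q j\<close>.
  For products this is the Leibniz rule for finite differences, with its second-order
  correction.\<close>

lemma fun_alg_coords_divide:
  fixes P :: "('i \<Rightarrow> complex fps) \<Rightarrow> complex"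
  assumes "P \<in> fun_alg coords"
  shows "\<exists>Q\<in>fun_alg coords. \<forall>q. P q = P (q(j := q j - fps_const (fps_nth (q j) 0))) + fps_nth (q j) 0 * Q q"
  using assms
proof induction
  case (const c)
  show ?case by (intro bexI[OF _ fun_alg.const[of 0]]) simp
next
  case (gen g)
  then obtain i k where g: "g = (\<lambda>q. fps_nth (q i) k)" by (auto simp: coords_def)
  show ?case
    by (rule bexI[OF _ fun_alg.const[of "if i = j \<and> k = 0 then 1 else 0"]]) (auto simp: g)
next
  case (add f g)
  then obtain Q Q' where *: "Q \<in> fun_alg coords" "Q' \<in> fun_alg coords"
    "\<And>q. f q = f (q(j := q j - fps_const (fps_nth (q j) 0))) + fps_nth (q j) 0 * Q q"
    "\<And>q. g q = g (q(j := q j - fps_const (fps_nth (q j) 0))) + fps_nth (q j) 0 * Q' q" by blast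
  show ?case
    by (rule bexI[OF _ fun_alg.add[OF *(1,2)]], rule allI, subst *(3), subst *(4)) (simp add: algebra_simps)
next
  case (mult f g)
  then obtain Q Q' where *: "Q \<in> fun_alg coords" "Q' \<in> fun_alg coords"
    "\<And>q. f q = f (q(j := q j - fps_const (fps_nth (q j) 0))) + fps_nth (q j) 0 * Q q"
    "\<And>q. g q = g (q(j := q j - fps_const (fps_nth (q j) 0))) + fps_nth (q j) 0 * Q' q" by blast
  have f: "f q - fps_nth (q j) 0 * Q q = f (q(j := q j - fps_const (fps_nth (q j) 0)))" for q
    using *(3)[of q] by simp
  have g: "g q - fps_nth (q j) 0 * Q' q = g (q(j := q j - fps_const (fps_nth (q j) 0)))" for q
    using *(4)[of q] by simp
  have c: "(\<lambda>q. fps_nth (q j) 0) \<in> fun_alg coords" by (rule coord_in)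
  let ?Q = "\<lambda>q. Q q * g q + f q * Q' q - fps_nth (q j) 0 * (Q q * Q' q)"
  show ?case
  proof (rule bexI[of _ ?Q])
    show "?Q \<in> fun_alg coords"
      by (intro fun_alg_diff fun_alg.add fun_alg.mult mult.hyps * c)
    show "\<forall>q. f q * g q = f (q(j := q j - fps_const (fps_nth (q j) 0))) * g (q(j := q j - fps_const (fps_nth (q j) 0)))
        + fps_nth (q j) 0 * ?Q q"
      unfolding f[symmetric] g[symmetric] by (simp add: algebra_simps)
  qed
qed

text \<open>With \<open>Xf = s\<close>, \<open>Ye = 1\<close> and \<open>Yh = 0\<close>, the
  equations for \<open>QE\<close> and \<open>QH\<close> determine \<open>Yf\<close> and
  \<open>Xe\<close>, and the one for \<open>QF\<close> asks for a square root. Its radicand has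
  constant term \<open>4 * s * (?D * s - ?B)\<close> because that of \<open>q QF\<close> is zero;
  \<open>s\<close> is chosen to make this nonzero.\<close>

lemma quads_surj:
  fixes q :: "quad \<Rightarrow> complex fps"
  assumes "fps_nth (q QF) 0 = 0" "fps_nth (q QE) 0 \<noteq> 0"
  obtains p where "quads p = q"
proof -
  let ?B = "fps_nth (q QH) 0" and ?D = "fps_nth (q QE) 0"
  define s where "s = (if ?B = ?D then 2 else 1 :: complex)"
  have s: "s \<noteq> 0" "?D * s - ?B \<noteq> 0" using assms(2) by (auto simp: s_def)
  let ?f = "fps_const s"
  have "fps_nth (q QF - 4 * (q QH - ?f * q QE) * ?f) 0 \<noteq> 0"
    using s assms by (simp add: numeral_fps_const mult.commute)
  then obtain r where r: "r ^ 2 = q QF - 4 * (q QH - ?f * q QE) * ?f"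
    using fps_sqrt_exists by blast
  have "quads (pt (q QH - ?f * q QE) ?f r 1 (q QE) 0) = q"
  proof
    fix j show "quads (pt (q QH - ?f * q QE) ?f r 1 (q QE) 0) j = q j"
      by (cases j) (simp_all add: r)
  qed
  then show ?thesis using that by blast
qed

context flow_invariant
begin

theorem factors_through_quads:
  obtains P where "P \<in> fun_alg coords" "\<And>p. F p = P (quads p)"
proof -
  have fpsl: "(\<lambda>r. r i) \<in> fps_alg loc_coords" for i
    by (rule fps_alg_coord) auto
  have "(\<lambda>r. normal_pt r i) \<in> fps_alg loc_coords" for i
    unfolding normal_pt_def
    by (cases i) (auto intro!: fps_alg_const fps_alg_diff fps_alg_mult fps_alg_power fps_alg_inverse fpsl
        fun_alg.gen)
  then have "(\<lambda>r. F (normal_pt r)) \<in> fun_alg loc_coords"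
    by (rule fun_alg_coords_compose[OF polynomial])
  then obtain U V where EO: "U \<in> fun_alg loc_coords" "V \<in> fun_alg loc_coords"
    "\<And>q r. r ^ 2 = q QF \<Longrightarrow> fps_nth r 0 \<noteq> 0 \<Longrightarrow> F (normal_pt (q(QF := r))) = U q + fps_nth r 0 * V q"
    using even_odd_decomposition by blast
  obtain M P where P: "P \<in> fun_alg coords"
    "\<And>q. fps_nth (q QF) 0 \<noteq> 0 \<Longrightarrow> U q * fps_nth (q QF) 0 ^ M = P q"
    using loc_coords_clear[OF EO(1)] by blast
  have fpsq: "(\<lambda>p. quads p j) \<in> fps_alg coords" for j
    by (cases j) (simp_all, auto intro!: fps_alg_add fps_alg_mult fps_alg_power fps_alg_const fps_alg_coord)
  have Pq: "(\<lambda>p. P (quads p)) \<in> fun_alg coords" if "P \<in> fun_alg coords" for P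
    by (rule fun_alg_coords_compose[OF that fpsq])
  have generic: "F p * fps_nth (quads p QF) 0 ^ M = P (quads p)"
    if g: "fps_nth (p Xe) 0 \<noteq> 0" "fps_nth (p Xf) 0 \<noteq> 0" "fps_nth (quads p QF) 0 \<noteq> 0"
     "fps_nth (quads p QF * quads p QE - quads p QH ^ 2) 0 \<noteq> 0" for p
  proof -
    obtain r where r: "r ^ 2 = quads p QF" using fps_sqrt_exists[OF g(3)] by blast
    then have r': "(- r) ^ 2 = quads p QF" by simp
    have r0: "fps_nth r 0 \<noteq> 0" "fps_nth (- r) 0 \<noteq> 0"
      using g(3) unfolding r[symmetric] by (auto simp: power2_eq_square)
    have "F p = U (quads p) + fps_nth r 0 * V (quads p)"
      using normal_form[OF g r] EO(3)[of r "quads p", OF r r0(1)] by simp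
    moreover have "F p = U (quads p) - fps_nth r 0 * V (quads p)"
      using normal_form[OF g r'] EO(3)[of "- r" "quads p", OF r' r0(2)] by simp
    ultimately have "2 * F p = 2 * U (quads p)" by simp
    then show ?thesis using P(2)[of "quads p"] g(3) by simp
  qed
  have clear: "\<exists>P\<in>fun_alg coords. \<forall>p. F p * fps_nth (quads p QF) 0 ^ M = P (quads p)"
  proof (rule bexI[OF _ P(1)], rule allI)
    fix p
    let ?K = "\<lambda>p :: gen \<Rightarrow> complex fps. fps_nth (p Xe) 0 * fps_nth (p Xf) 0 * fps_nth (quads p QF) 0
      * fps_nth (quads p QF * quads p QE - quads p QH ^ 2) 0"
    have "F p * fps_nth (quads p QF) 0 ^ M - P (quads p) = 0"
    proof (rule fun_alg_coords_zero_product[where g = ?K and f = "\<lambda>p. F p * fps_nth (quads p QF) 0 ^ M - P (quads p)"])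
      show "(\<lambda>p. F p * fps_nth (quads p QF) 0 ^ M - P (quads p)) \<in> fun_alg coords"
        by (intro fun_alg_diff fun_alg.mult polynomial fun_alg_power fps_algD fpsq Pq P)
      show "?K \<in> fun_alg coords"
        by (intro fun_alg.mult coord_in fps_algD fpsq fps_alg_diff fps_alg_mult fps_alg_power)
      \<comment> \<open>At this point \<open>QF\<close>, \<open>QE\<close>, \<open>QH\<close> are
        \<open>4\<close>, \<open>1\<close>, \<open>1\<close>, so the last factor is
        \<open>3\<close>.\<close>
      show "?K (pt 1 1 0 1 0 1) \<noteq> 0" by (simp add: numeral_fps_const)
    qed (use generic in auto)
    then show "F p * fps_nth (quads p QF) 0 ^ M = P (quads p)" by simp
  qed
  have "\<exists>P\<in>fun_alg coords. \<forall>p. F p = P (quads p)"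
    using clear
  proof (induction M)
    case (Suc M)
    then obtain P where P: "P \<in> fun_alg coords"
      "\<And>p. F p * fps_nth (quads p QF) 0 ^ Suc M = P (quads p)" by blast
    obtain Q where Q: "Q \<in> fun_alg coords"
      "\<And>q. P q = P (q(QF := q QF - fps_const (fps_nth (q QF) 0))) + fps_nth (q QF) 0 * Q q"
      using fun_alg_coords_divide[OF P(1), of QF] by blast
    \<comment> \<open>Points of the hypersurface where the constant term of \<open>QE\<close> is
      nonzero are values of \<open>quads\<close>, and there the left side of \<open>P(2)\<close>
      vanishes. Density in the coordinates of \<open>q\<close> does the rest.\<close>
    have zero: "P (q(QF := q QF - fps_const (fps_nth (q QF) 0))) = 0" for q
    proof (rule fun_alg_coords_zero_product[where g = "\<lambda>q. fps_nth (q QE) 0" and q = "\<lambda>_. 1"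
          and f = "\<lambda>q. P (q(QF := q QF - fps_const (fps_nth (q QF) 0)))"])
      show "(\<lambda>q. P (q(QF := q QF - fps_const (fps_nth (q QF) 0)))) \<in> fun_alg coords"
      proof (rule fun_alg_coords_compose[OF P(1)])
        fix i :: quad
        show "(\<lambda>x. (x(QF := x QF - fps_const (fps_nth (x QF) 0))) i) \<in> fps_alg coords"
          by (cases "i = QF") (auto intro!: fps_alg_diff fps_alg_coord fps_alg_fps_const coord_in)
      qed
      show "(\<lambda>q. fps_nth (q QE) 0) \<in> fun_alg coords" by (rule coord_in)
    next
      fix q :: "quad \<Rightarrow> complex fps" assume "fps_nth (q QE) 0 \<noteq> 0"
      let ?q = "q(QF := q QF - fps_const (fps_nth (q QF) 0))"
      obtain p where p: "quads p = ?q"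
        by (rule quads_surj[of ?q]) (use \<open>fps_nth (q QE) 0 \<noteq> 0\<close> in auto)
      show "P ?q = 0" using P(2)[of p] unfolding p by simp
    qed simp
    have "F p * fps_nth (quads p QF) 0 ^ M = Q (quads p)" for p
    proof -
      have "F p * fps_nth (quads p QF) 0 ^ M - Q (quads p) = 0"
      proof (rule fun_alg_coords_zero_product[where g = "\<lambda>p. fps_nth (quads p QF) 0"
            and f = "\<lambda>p. F p * fps_nth (quads p QF) 0 ^ M - Q (quads p)"])
        show "(\<lambda>p. F p * fps_nth (quads p QF) 0 ^ M - Q (quads p)) \<in> fun_alg coords"
          by (intro fun_alg_diff fun_alg.mult polynomial fun_alg_power fps_algD fpsq Pq Q)
        show "(\<lambda>p. fps_nth (quads p QF) 0) \<in> fun_alg coords" by (rule fps_algD[OF fpsq])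
        show "fps_nth (quads (pt 1 1 1 1 1 1) QF) 0 \<noteq> (0::complex)" by (simp add: numeral_fps_const)
        show "F p * fps_nth (quads p QF) 0 ^ M - Q (quads p) = 0" if "fps_nth (quads p QF) 0 \<noteq> 0" for p
        proof -
          have "fps_nth (quads p QF) 0 * (F p * fps_nth (quads p QF) 0 ^ M) = P (quads p)"
            unfolding P(2)[symmetric] by simp
          also have "\<dots> = fps_nth (quads p QF) 0 * Q (quads p)"
            by (subst Q(2)) (simp only: zero add_0)
          finally show ?thesis using that by simp
        qed
      qed
      then show ?thesis by simp
    qed
    then show ?case using Suc.IH Q(1) by blast
  qed simp
  then show ?thesis using that by blast
qed

end

section \<open>Modes in vertex algebras\<close>

context vertex_algebra
begin

sublocale VS: vector_space "vscale W"
  by (rule vspace)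

lemma nprod_add_right: "nprod W u n (v + w) = nprod W u n v + nprod W u n w"
proof -
  interpret l: Vector_Spaces.linear "vscale W" "vscale W" "nprod W u n" by (rule nprod_linear_right)
  show ?thesis by (rule l.add)
qed

lemma nprod_scale_right: "nprod W u n (vscale W c v) = vscale W c (nprod W u n v)"
proof -
  interpret l: Vector_Spaces.linear "vscale W" "vscale W" "nprod W u n" by (rule nprod_linear_right)
  show ?thesis by (rule l.scale)
qed

lemma nprod_add_left: "nprod W (u + u') n v = nprod W u n v + nprod W u' n v"
proof -
  interpret l: Vector_Spaces.linear "vscale W" "vscale W" "\<lambda>u. nprod W u n v" by (rule nprod_linear_left)
  show ?thesis by (rule l.add)
qed

lemma nprod_scale_left: "nprod W (vscale W c u) n v = vscale W c (nprod W u n v)"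
proof -
  interpret l: Vector_Spaces.linear "vscale W" "vscale W" "\<lambda>u. nprod W u n v" by (rule nprod_linear_left)
  show ?thesis by (rule l.scale)
qed

lemma nprod_zero_right: "nprod W u n 0 = 0"
  using nprod_add_right[of u n 0 0] by simp

lemma nprod_zero_left: "nprod W 0 n v = 0"
  using nprod_add_left[of 0 0 n v] by simp

lemma nprod_minus_right: "nprod W u n (- v) = - nprod W u n v"
  using nprod_scale_right[of u n "-1" v] by simp

lemma nprod_minus_left: "nprod W (- u) n v = - nprod W u n v"
  using nprod_scale_left[of "-1" u n v] by simp

lemma nprod_diff_right: "nprod W u n (v - w) = nprod W u n v - nprod W u n w"
  using nprod_add_right[of u n v "- w"] by (simp add: nprod_minus_right)

lemma nprod_diff_left: "nprod W (u - u') n v = nprod W u n v - nprod W u' n v"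
  using nprod_add_left[of u "- u'" n v] by (simp add: nprod_minus_left)

lemmas nprod_simps = nprod_add_right nprod_add_left nprod_scale_right nprod_scale_left
  nprod_zero_right nprod_zero_left nprod_minus_right nprod_minus_left nprod_diff_right nprod_diff_left

text \<open>The Borcherds identity at \<open>n = 0\<close>, where the binomial coefficients on the
  right vanish except for \<open>j = 0\<close>.\<close>

lemma nprod_commutator:
  assumes "\<And>j. J \<le> j \<Longrightarrow> nprod W u (int j) v = 0"
  shows "nprod W u m (nprod W v k w) = nprod W v k (nprod W u m w)
    + (\<Sum>j<J. vscale W (of_int m gchoose j) (nprod W (nprod W u (int j) v) (m + k - int j) w))"
proof -
  let ?L = "\<lambda>j. vscale W (of_int m gchoose j) (nprod W (nprod W u (0 + int j) v) (m + k - int j) w)"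
  let ?R = "\<lambda>j. vscale W ((-1) ^ j * (of_int 0 gchoose j))
          (nprod W u (m + 0 - int j) (nprod W v (k + int j) w)
           - vscale W ((-1) powi 0) (nprod W v (0 + k - int j) (nprod W u (m + int j) w)))"
  have "Sum_any ?L = (\<Sum>j<J. ?L j)"
  proof (rule Sum_any.expand_superset)
    have "?L j = 0" if "J \<le> j" for j
      by (simp only: add_0 assms[OF that] nprod_zero_left VS.scale_zero_right)
    then show "{j. ?L j \<noteq> 0} \<subseteq> {..<J}" using not_le by blast
  qed simp
  moreover have "Sum_any ?R = (\<Sum>j\<in>{0}. ?R j)"
  proof (rule Sum_any.expand_superset)
    have "?R j = 0" if "j \<noteq> 0" for j using that by (cases j) simp_all
    then show "{a. ?R a \<noteq> 0} \<subseteq> {0}" by blast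
  qed simp
  ultimately show ?thesis using borcherds[of m u 0 v k w] by simp
qed

lemma nprod_commutator_simple_pole:
  assumes "\<And>j. 0 < j \<Longrightarrow> nprod W u (int j) v = 0"
  shows "nprod W u m (nprod W v k w) = nprod W v k (nprod W u m w) + nprod W (nprod W u 0 v) (m + k) w"
  using nprod_commutator[of 1 u v m k w] assms by simp

lemma gbinomial_neg_one: "(- 1 gchoose j) = ((- 1) ^ j :: complex)"
  by (simp add: gbinomial_minus) (simp flip: binomial_gbinomial)

lemma gbinomial_neg_two: "(- 2 gchoose j) = ((- 1) ^ j * of_nat (Suc j) :: complex)"
proof -
  have "(of_nat (Suc j) gchoose j) = (of_nat (Suc j) :: complex)"
    by (simp del: of_nat_Suc flip: binomial_gbinomial)
  then show ?thesis using gbinomial_minus[of "2 :: complex" j] by (simp add: algebra_simps)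
qed

text \<open>The Borcherds identity at \<open>m = 0\<close>, \<open>n = -1\<close>; the two signs in
  each summand cancel. The bound \<open>J\<close> replaces the infinite normally ordered sum by a
  finite one.\<close>

lemma wick_mode:
  assumes "\<And>j. J \<le> j \<Longrightarrow> nprod W v (k + int j) w = 0" "\<And>j. J \<le> j \<Longrightarrow> nprod W u (int j) w = 0"
  shows "nprod W (wick W u v) k w =
    (\<Sum>j<J. nprod W u (- 1 - int j) (nprod W v (k + int j) w) + nprod W v (k - 1 - int j) (nprod W u (int j) w))"
proof -
  let ?L = "\<lambda>j. vscale W (of_int 0 gchoose j) (nprod W (nprod W u (- 1 + int j) v) (0 + k - int j) w)"
  let ?R = "\<lambda>j. vscale W ((-1) ^ j * (of_int (-1) gchoose j))
          (nprod W u (0 + (-1) - int j) (nprod W v (k + int j) w)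
           - vscale W ((-1) powi (-1)) (nprod W v ((-1) + k - int j) (nprod W u (0 + int j) w)))"
  have "Sum_any ?L = (\<Sum>j\<in>{0}. ?L j)"
  proof (rule Sum_any.expand_superset)
    have "?L j = 0" if "j \<noteq> 0" for j using that by (cases j) simp_all
    then show "{a. ?L a \<noteq> 0} \<subseteq> {0}" by blast
  qed simp
  moreover have "Sum_any ?R = (\<Sum>j<J. ?R j)"
  proof (rule Sum_any.expand_superset)
    have "?R j = 0" if "J \<le> j" for j
      by (simp only: add_0 assms[OF that] nprod_zero_right VS.scale_zero_right diff_self)
    then show "{j. ?R j \<noteq> 0} \<subseteq> {..<J}" using not_le by blast
  qed simp
  ultimately show ?thesis
    using borcherds[of 0 u "-1" v k w]
    by (simp add: wick_def gbinomial_neg_one algebra_simps flip: power_mult_distrib)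
qed

text \<open>The Borcherds identity at \<open>m = 0\<close>, \<open>n = -2\<close> against the
  vacuum: only the summand \<open>j = k\<close> survives, and its binomial coefficient supplies the
  factor.\<close>

lemma translation_mode:
  "nprod W (translation W u) (- 1 - int k) w = vscale W (of_nat (Suc k)) (nprod W u (- 1 - int (Suc k)) w)"
proof -
  let ?L = "\<lambda>j. vscale W (of_int 0 gchoose j) (nprod W (nprod W u (- 2 + int j) (vacuum W)) (0 + (- 1 - int k) - int j) w)"
  let ?R = "\<lambda>j. vscale W ((-1) ^ j * (of_int (-2) gchoose j))
          (nprod W u (0 + (-2) - int j) (nprod W (vacuum W) ((- 1 - int k) + int j) w)
           - vscale W ((-1) powi (-2)) (nprod W (vacuum W) ((-2) + (- 1 - int k) - int j) (nprod W u (0 + int j) w)))"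
  have "Sum_any ?L = (\<Sum>j\<in>{0}. ?L j)"
  proof (rule Sum_any.expand_superset)
    have "?L j = 0" if "j \<noteq> 0" for j using that by (cases j) simp_all
    then show "{a. ?L a \<noteq> 0} \<subseteq> {0}" by blast
  qed simp
  moreover have "Sum_any ?R = (\<Sum>j\<in>{k}. ?R j)"
    by (rule Sum_any.expand_superset) (auto simp: vacuum_left nprod_simps)
  moreover have e: "- 1 - int (Suc k) = - 2 - int k" by simp
  ultimately show ?thesis
    unfolding e using borcherds[of 0 u "-2" "vacuum W" "- 1 - int k" w]
    by (simp add: translation_def gbinomial_neg_two vacuum_left algebra_simps flip: power_mult_distrib)
qed

lemma translation_power_mode:
  "nprod W ((translation W ^^ k) u) (- 1 - int m) w
    = vscale W (fact (m + k) / fact m) (nprod W u (- 1 - int (m + k)) w)"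
proof (induction k arbitrary: m)
  case (Suc k)
  show ?case
    using Suc.IH[of "Suc m"] translation_mode[of "(translation W ^^ k) u" m w]
    by (simp add: field_simps del: of_nat_Suc)
qed simp

text \<open>At \<open>m = 0\<close> every summand on the right of the Borcherds identity applies a
  non-negative mode of \<open>a\<close> or \<open>b\<close> directly to \<open>v\<close>. Hence a
  vector killed by some currents is killed by everything they generate.\<close>

lemma annihilator_nprod:
  assumes "\<And>n. 0 \<le> n \<Longrightarrow> nprod W a n v = 0" "\<And>n. 0 \<le> n \<Longrightarrow> nprod W b n v = 0" "0 \<le> n"
  shows "nprod W (nprod W a m b) n v = 0"
proof -
  let ?L = "\<lambda>j. vscale W (of_int 0 gchoose j) (nprod W (nprod W a (m + int j) b) (0 + n - int j) v)"
  have "Sum_any ?L = (\<Sum>j\<in>{0}. ?L j)"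
  proof (rule Sum_any.expand_superset)
    have "?L j = 0" if "j \<noteq> 0" for j using that by (cases j) simp_all
    then show "{a. ?L a \<noteq> 0} \<subseteq> {0}" by blast
  qed simp
  then show ?thesis
    using borcherds[of 0 a m b n v] assms by (simp add: nprod_simps)
qed

lemma subspace_annihilator: "VS.subspace {a. \<forall>n\<ge>0. nprod W a n v = 0}"
  by (rule VS.subspaceI) (auto simp: nprod_simps)

lemma subspace_commutant: "VS.subspace (commutant W U)"
  by (rule VS.subspaceI) (auto simp: commutant_def nprod_simps)

lemma vacuum_in_commutant: "vacuum W \<in> commutant W U"
  by (auto simp: commutant_def creation_regular)

text \<open>Without singular terms between an element of \<open>U\<close> and \<open>a\<close>, all
  their modes commute.\<close>

lemma commutant_nprod:
  assumes "a \<in> commutant W U" "b \<in> commutant W U"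
  shows "nprod W a n b \<in> commutant W U"
  using assms nprod_commutator[of 0 _ a _ n b]
  by (auto simp: commutant_def nprod_simps)

end

lemma digit_sum_eq:
  fixes a b :: "nat \<Rightarrow> nat"
  assumes "(\<Sum>j<n. a j * B ^ j) = (\<Sum>j<n. b j * B ^ j)"
    and "\<And>j. a j < B" "\<And>j. b j < B" and "j < n"
  shows "a j = b j"
  using assms
proof (induction n arbitrary: a b j)
  case (Suc n)
  have s: "(\<Sum>j<Suc n. f j * B ^ j) = f 0 + B * (\<Sum>j<n. f (Suc j) * B ^ j)" for f
    by (subst sum.lessThan_Suc_shift) (simp add: sum_distrib_left algebra_simps)
  have eq: "a 0 + B * (\<Sum>j<n. a (Suc j) * B ^ j) = b 0 + B * (\<Sum>j<n. b (Suc j) * B ^ j)"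
    using Suc.prems(1) unfolding s .
  have 0: "a 0 = b 0"
    using arg_cong[OF eq, of "\<lambda>x. x mod B"] Suc.prems(2,3)[of 0] by simp
  have B: "B > 0" using Suc.prems(2)[of 0] by simp
  with eq 0 have "(\<Sum>j<n. a (Suc j) * B ^ j) = (\<Sum>j<n. b (Suc j) * B ^ j)" by simp
  from Suc.IH[OF this] Suc.prems(2,3) have "j < n \<Longrightarrow> a (Suc j) = b (Suc j)" for j by blast
  then show ?case using 0 Suc.prems(4) by (cases j) auto
qed simp

text \<open>
  Kronecker substitution: substituting \<open>s\<^bsup>B^i\<^esup>\<close> for the \<open>i\<close>-th variable sends distinct monomials to
  distinct powers of \<open>s\<close>.
\<close>

lemma monomial_functions_independent:
  fixes c :: "'a multiset \<Rightarrow> complex"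
  assumes fin: "finite A" and zero: "\<And>x. (\<Sum>M\<in>A. c M * prod_mset (image_mset x M)) = 0" and "M \<in> A"
  shows "c M = 0"
proof -
  define V where "V = (\<Union>M\<in>A. set_mset M)"
  have "finite V" using fin by (simp add: V_def)
  then obtain enc :: "'a \<Rightarrow> nat" and n where enc: "enc ` V = {i. i < n}" "inj_on enc V"
    using finite_imp_inj_to_nat_seg[OF \<open>finite V\<close>] by (elim exE conjE) (rule that)
  \<comment> \<open>Larger than every multiplicity, so that multiplicities are base-\<open>B\<close>
    digits of the weight and can be recovered from it.\<close>
  define B where "B = Suc (\<Sum>M\<in>A. size M)"
  define wt where "wt M = (\<Sum>a\<in>#M. B ^ enc a)" for M
  have x: "prod_mset (image_mset (\<lambda>a. s ^ (B ^ enc a)) M) = s ^ wt M" for s :: complex and M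
    unfolding wt_def by (induction M) (simp_all add: power_add)
  have size: "count N a < B" if "N \<in> A" for N a
  proof -
    have "count N a \<le> size N" by (rule count_le_size)
    also have "\<dots> \<le> (\<Sum>M\<in>A. size M)" using fin that by (intro member_le_sum) auto
    finally show ?thesis by (simp add: B_def)
  qed
  have wt: "wt N = (\<Sum>j<n. count N (inv_into V enc j) * B ^ j)" if "N \<in> A" for N
  proof -
    have sub: "set_mset N \<subseteq> V" using that by (auto simp: V_def)
    have "(\<Sum>a\<in>#N. B ^ enc a) = (\<Sum>a\<in>V. count N a * B ^ enc a)"
      using sub
    proof (induction N)
      case (add x N)
      have "(\<Sum>a\<in>V. count (add_mset x N) a * B ^ enc a)
          = (\<Sum>a\<in>V. count N a * B ^ enc a + (if a = x then B ^ enc a else 0))"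
        by (rule sum.cong) auto
      then show ?case using add \<open>finite V\<close> by (simp add: sum.distrib)
    qed simp
    then have "wt N = (\<Sum>a\<in>V. count N a * B ^ enc a)" by (simp add: wt_def)
    also have "\<dots> = (\<Sum>j\<in>enc ` V. count N (inv_into V enc j) * B ^ j)"
      by (subst sum.reindex[OF enc(2)]) (simp add: enc(2))
    also have "enc ` V = {..<n}" using enc(1) by auto
    finally show ?thesis .
  qed
  have inj: "inj_on wt A"
  proof (rule inj_onI)
    fix M N assume MN: "M \<in> A" "N \<in> A" "wt M = wt N"
    have eq: "count M (inv_into V enc j) = count N (inv_into V enc j)" if "j < n" for j
      using digit_sum_eq[where n = n and B = B and j = j and a = "\<lambda>j. count M (inv_into V enc j)"
          and b = "\<lambda>j. count N (inv_into V enc j)"]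
        wt size MN that by simp
    show "M = N"
    proof (rule multiset_eqI)
      fix a
      show "count M a = count N a"
      proof (cases "a \<in> V")
        case True
        then have "enc a < n" using enc(1) by blast
        from eq[OF this] show ?thesis using True enc(2) by simp
      next
        case False
        then have "a \<notin># M" "a \<notin># N" using MN by (auto simp: V_def)
        then show ?thesis by (simp add: not_in_iff)
      qed
    qed
  qed
  define P where "P = (\<Sum>M\<in>A. monom (c M) (wt M))"
  have "poly P s = 0" for s
    using zero[of "\<lambda>a. s ^ (B ^ enc a)"] by (simp add: P_def poly_sum poly_monom x)
  then have "P = 0" using poly_all_0_iff_0 by blast
  then have "0 = coeff P (wt M)" by simp
  also have "\<dots> = (\<Sum>N\<in>A. if N = M then c N else 0)"
    unfolding P_def coeff_sum coeff_monom
    by (intro sum.cong refl) (use inj \<open>M \<in> A\<close> in \<open>auto dest: inj_onD\<close>)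
  also have "\<dots> = c M" using fin \<open>M \<in> A\<close> by simp
  finally show ?thesis by simp
qed

section \<open>Fock spaces and the action of currents on leading parts\<close>

locale free_field = vertex_algebra W
  for W :: "'w::ab_group_add vertex_alg" +
  fixes g :: "'i \<Rightarrow> 'w" and \<eta> :: "'i \<Rightarrow> 'i \<Rightarrow> complex"
  assumes ope: "n \<ge> 0 \<Longrightarrow> nprod W (g i) n (g j) = (if n = 0 then vscale W (\<eta> i j) (vacuum W) else 0)"
begin

lemma mode_commute:
  "nprod W (g i) m (nprod W (g j) k w) =
     nprod W (g j) k (nprod W (g i) m w) + (if m + k = -1 then vscale W (\<eta> i j) w else 0)"
  using nprod_commutator_simple_pole[of "g i" "g j" m k w]
  by (simp add: ope nprod_scale_left vacuum_left)

definition crea :: "'i \<Rightarrow> nat \<Rightarrow> 'w \<Rightarrow> 'w" where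
  "crea i k = nprod W (g i) (- 1 - int k)"

lemma crea_commute: "crea i k (crea j l w) = crea j l (crea i k w)"
  using mode_commute[of i "- 1 - int k" j "- 1 - int l" w] by (simp add: crea_def)

definition fm :: "('i \<times> nat) multiset \<Rightarrow> 'w" where
  "fm = fold_mset (\<lambda>(i, k). crea i k) (vacuum W)"

lemma fm_empty: "fm {#} = vacuum W"
  by (simp add: fm_def)

lemma fm_add: "fm (add_mset (i, k) M) = crea i k (fm M)"
proof -
  interpret comp_fun_commute "\<lambda>(i, k). crea i k"
    by standard (auto simp: fun_eq_iff crea_commute)
  show ?thesis by (simp add: fm_def)
qed

lemma crea_simps:
  "crea i k (v + w) = crea i k v + crea i k w"
  "crea i k (vscale W c v) = vscale W c (crea i k v)"
  "crea i k 0 = 0"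
  "crea i k (v - w) = crea i k v - crea i k w"
  by (simp_all add: crea_def nprod_simps)

end

section \<open>Fock vectors as polynomial functions on arcs, and the degree filtration\<close>

locale fock_space = free_field W g \<eta>
  for W :: "'w::ab_group_add vertex_alg" and g :: "'i \<Rightarrow> 'w" and \<eta> :: "'i \<Rightarrow> 'i \<Rightarrow> complex" +
  assumes fm_inj: "inj fm"
    and fm_independent: "\<not> VS.dependent (range fm)"
    and fm_span: "VS.span (range fm) = UNIV"
begin

lemma fm_eq_iff: "fm M = fm N \<longleftrightarrow> M = N"
  using fm_inj by (simp add: inj_eq)

lemma basis_induct [case_names zero fm add scale]:
  assumes "P 0" "\<And>M. P (fm M)" "\<And>v w. P v \<Longrightarrow> P w \<Longrightarrow> P (v + w)" "\<And>c v. P v \<Longrightarrow> P (vscale W c v)"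
  shows "P v"
proof -
  have "v \<in> VS.span (range fm)" using fm_span by simp
  moreover have "VS.subspace {v. P v}" using assms by (intro VS.subspaceI) auto
  ultimately show ?thesis using VS.span_induct[of v "range fm" P] assms by auto
qed

lemma vspair_complex: "vector_space_pair (vscale W) ((*) :: complex \<Rightarrow> complex \<Rightarrow> complex)"
  by unfold_locales (auto simp: algebra_simps VS.scale_right_distrib VS.scale_left_distrib)

lemma vspair_self: "vector_space_pair (vscale W) (vscale W)"
  by unfold_locales (auto simp: VS.scale_right_distrib VS.scale_left_distrib)

definition monom_at :: "('i \<Rightarrow> complex fps) \<Rightarrow> ('i \<times> nat) multiset \<Rightarrow> complex" where
  "monom_at p M = prod_mset (image_mset (\<lambda>(i, k). fps_nth (p i) k) M)"

text \<open>Identifies the Fock space with polynomial functions on arcs: the operator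
  \<open>crea i k\<close> becomes multiplication by the coefficient of \<open>t^k\<close> in the
  coordinate \<open>i\<close>.\<close>

definition ev :: "'w \<Rightarrow> ('i \<Rightarrow> complex fps) \<Rightarrow> complex" where
  "ev v p = vector_space_pair.construct (vscale W) (*) (range fm) (\<lambda>b. monom_at p (inv fm b)) v"

definition pr :: "nat \<Rightarrow> 'w \<Rightarrow> 'w" where
  "pr d = vector_space_pair.construct (vscale W) (vscale W) (range fm)
     (\<lambda>b. if size (inv fm b) = d then b else 0)"

lemma ev_linear:
  "ev (v + w) p = ev v p + ev w p" "ev (vscale W c v) p = c * ev v p" "ev 0 p = 0"
  "ev (v - w) p = ev v p - ev w p"
proof -
  interpret vector_space_pair "vscale W" "(*) :: complex \<Rightarrow> complex \<Rightarrow> complex" by (rule vspair_complex)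
  interpret l: Vector_Spaces.linear "vscale W" "(*)" "\<lambda>v. ev v p"
    unfolding ev_def by (rule linear_construct[OF fm_independent])
  show "ev (v + w) p = ev v p + ev w p" "ev (vscale W c v) p = c * ev v p" "ev 0 p = 0"
    "ev (v - w) p = ev v p - ev w p"
    by (rule l.add l.scale l.zero l.diff)+
qed

lemma ev_fm: "ev (fm M) p = monom_at p M"
proof -
  interpret vector_space_pair "vscale W" "(*) :: complex \<Rightarrow> complex \<Rightarrow> complex" by (rule vspair_complex)
  show ?thesis
    using construct_basis[OF fm_independent, of "fm M" "\<lambda>b. monom_at p (inv fm b)"]
    by (simp add: ev_def fm_inj)
qed

lemma pr_linear:
  "pr d (v + w) = pr d v + pr d w" "pr d (vscale W c v) = vscale W c (pr d v)" "pr d 0 = 0"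
  "pr d (v - w) = pr d v - pr d w"
proof -
  interpret vector_space_pair "vscale W" "vscale W" by (rule vspair_self)
  interpret l: Vector_Spaces.linear "vscale W" "vscale W" "pr d"
    unfolding pr_def by (rule linear_construct[OF fm_independent])
  show "pr d (v + w) = pr d v + pr d w" "pr d (vscale W c v) = vscale W c (pr d v)" "pr d 0 = 0"
    "pr d (v - w) = pr d v - pr d w"
    by (rule l.add l.scale l.zero l.diff)+
qed

lemma pr_fm: "pr d (fm M) = (if size M = d then fm M else 0)"
proof -
  interpret vector_space_pair "vscale W" "vscale W" by (rule vspair_self)
  show ?thesis
    using construct_basis[OF fm_independent, of "fm M" "\<lambda>b. if size (inv fm b) = d then b else 0"]
    by (simp add: pr_def fm_inj)
qed

lemma ev_vacuum: "ev (vacuum W) p = 1"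
  using ev_fm[of "{#}" p] by (simp add: fm_empty monom_at_def)

lemma ev_crea: "ev (crea i k v) p = fps_nth (p i) k * ev v p"
  by (induction v rule: basis_induct)
    (simp_all add: crea_simps ev_linear algebra_simps ev_fm monom_at_def flip: fm_add)

lemma ev_sum: "ev (sum f A) p = (\<Sum>a\<in>A. ev (f a) p)"
  by (induction A rule: infinite_finite_induct) (simp_all add: ev_linear)

text \<open>Any assignment of numbers to the variables is realised by an arc with these
  coefficients, so the independence of monomial functions applies to a basis expansion of
  \<open>v\<close>.\<close>

lemma ev_inject:
  assumes "\<And>p. ev v p = 0"
  shows "v = 0"
proof -
  have "v \<in> VS.span (range fm)" using fm_span by simp
  then obtain t r where t: "finite t" "t \<subseteq> range fm" "v = (\<Sum>a\<in>t. vscale W (r a) a)"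
    unfolding VS.span_explicit by blast
  obtain A where A: "finite A" "t = fm ` A"
    using finite_subset_image[OF t(1,2)] by blast
  have v: "v = (\<Sum>M\<in>A. vscale W (r (fm M)) (fm M))"
    unfolding t(3) A(2) by (rule sum.reindex[simplified]) (use fm_inj in \<open>auto intro: inj_onI simp: fm_eq_iff\<close>)
  have "r (fm M) = 0" if "M \<in> A" for M
  proof (rule monomial_functions_independent[OF A(1) _ that, of "\<lambda>M. r (fm M)"])
    fix x :: "'i \<times> nat \<Rightarrow> complex"
    let ?p = "\<lambda>i. Abs_fps (\<lambda>k. x (i, k))"
    have "monom_at ?p M = prod_mset (image_mset x M)" for M
      unfolding monom_at_def by (intro arg_cong[where f = prod_mset] image_mset_cong) auto
    moreover have "ev v ?p = (\<Sum>M\<in>A. r (fm M) * monom_at ?p M)"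
      unfolding v by (simp add: ev_sum ev_linear ev_fm)
    ultimately show "(\<Sum>M\<in>A. r (fm M) * prod_mset (image_mset x M)) = 0"
      using assms[of ?p] by simp
  qed
  then show ?thesis unfolding v by simp
qed

lemma ev_polynomial: "ev v \<in> fun_alg coords"
proof (induction v rule: basis_induct)
  case zero
  show ?case using fun_alg.const[of 0] by (simp add: ev_linear[abs_def])
next
  case (fm M)
  have "(\<lambda>p. prod_mset (image_mset (\<lambda>(i, k). fps_nth (p i) k) M)) \<in> fun_alg coords"
    by (induction M) (auto intro: fun_alg.const fun_alg.mult coord_in)
  then show ?case by (simp add: ev_fm[abs_def] monom_at_def)
next
  case (add v w)
  then show ?case using fun_alg.add[OF add] by (simp add: ev_linear[abs_def])
next
  case (scale c v)
  then show ?case using fun_alg.mult[OF fun_alg.const scale] by (simp add: ev_linear[abs_def])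
qed

lemma pr_crea: "pr (Suc d) (crea i k v) = crea i k (pr d v)"
  by (induction v rule: basis_induct)
    (simp_all add: crea_simps pr_linear pr_fm flip: fm_add)

lemma pr_zero_crea: "pr 0 (crea i k v) = 0"
  by (induction v rule: basis_induct) (simp_all add: crea_simps pr_linear pr_fm flip: fm_add)

lemma pr_pr: "pr d (pr e v) = (if d = e then pr d v else 0)"
  by (induction v rule: basis_induct) (auto simp: pr_linear pr_fm)

text \<open>The bound is strict, so that \<open>below 0\<close> is the zero space, where the
  induction on degree starts. The leading part of a vector of \<open>below (Suc d)\<close> is its
  image under \<open>pr d\<close>.\<close>

definition below :: "nat \<Rightarrow> 'w set" where
  "below d = VS.span {fm M | M. size M < d}"

lemma subspace_below: "VS.subspace (below d)"
  by (simp add: below_def)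

lemmas below_closed = VS.subspace_0[OF subspace_below] VS.subspace_add[OF subspace_below]
  VS.subspace_scale[OF subspace_below] VS.subspace_diff[OF subspace_below]
  VS.subspace_sum[OF subspace_below]

lemma fm_below: "size M < d \<Longrightarrow> fm M \<in> below d"
  unfolding below_def by (rule VS.span_base) auto

lemma below_mono: "d \<le> e \<Longrightarrow> below d \<subseteq> below e"
  unfolding below_def by (rule VS.span_mono) auto

lemma vacuum_below: "vacuum W \<in> below (Suc 0)"
  using fm_below[of "{#}"] by (simp add: fm_empty)

lemma below_induct [consumes 1, case_names zero fm add scale]:
  assumes "v \<in> below d" "P 0" "\<And>M. size M < d \<Longrightarrow> P (fm M)" "\<And>v w. P v \<Longrightarrow> P w \<Longrightarrow> P (v + w)"
    "\<And>c v. P v \<Longrightarrow> P (vscale W c v)"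
  shows "P v"
proof -
  have "VS.subspace {v. P v}" using assms by (intro VS.subspaceI) auto
  then show ?thesis using VS.span_induct[of v "{fm M | M. size M < d}" P] assms by (auto simp: below_def)
qed

lemma ex_below: "\<exists>d. v \<in> below d"
proof (induction v rule: basis_induct)
  case (add v w)
  then obtain d e where "v \<in> below d" "w \<in> below e" by blast
  then have "v \<in> below (max d e)" "w \<in> below (max d e)"
    using below_mono[of d "max d e"] below_mono[of e "max d e"] by auto
  then show ?case using below_closed(2) by blast
next
  case (fm M)
  show ?case using fm_below[of M "Suc (size M)"] by blast
next
  case (scale c v)
  then show ?case using below_closed(3) by blast
qed (use below_closed(1) in blast)

lemma pr_below: "v \<in> below d \<Longrightarrow> d \<le> e \<Longrightarrow> pr e v = 0"
  by (induction rule: below_induct) (auto simp: pr_linear pr_fm)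

lemma diff_pr_below: "v \<in> below (Suc d) \<Longrightarrow> v - pr d v \<in> below d"
proof (induction rule: below_induct)
  case (fm M)
  then show ?case by (auto simp: pr_fm below_closed intro!: fm_below)
next
  case (add v w)
  then show ?case using below_closed(2)[OF add] by (simp add: pr_linear algebra_simps)
next
  case (scale c v)
  then show ?case using below_closed(3)[OF scale, of c] by (simp add: pr_linear VS.scale_right_diff_distrib)
qed (simp add: pr_linear below_closed)

lemma below_zero: "v \<in> below 0 \<Longrightarrow> v = 0"
  by (simp add: below_def)

lemma crea_below: "v \<in> below d \<Longrightarrow> crea i k v \<in> below (Suc d)"
proof (induction rule: below_induct)
  case (fm M)
  then show ?case using fm_below[of "add_mset (i, k) M" "Suc d"] by (simp add: fm_add)
qed (auto simp: crea_simps intro: below_closed)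

text \<open>Moving a non-negative mode to the vacuum leaves only contractions, each of which removes
  a factor.\<close>

lemma ann_fm_below: "0 \<le> n \<Longrightarrow> nprod W (g i) n (fm M) \<in> below (size M)"
proof (induction M)
  case empty
  then show ?case by (simp add: fm_empty creation_regular below_closed)
next
  case (add x M)
  obtain j k where x: "x = (j, k)" by force
  have "nprod W (g i) n (fm (add_mset x M)) = crea j k (nprod W (g i) n (fm M))
      + (if n + (- 1 - int k) = -1 then vscale W (\<eta> i j) (fm M) else 0)"
    unfolding x fm_add crea_def by (rule mode_commute)
  also have "\<dots> \<in> below (Suc (size M))"
    using crea_below[OF add.IH[OF add.prems]] fm_below[of M "Suc (size M)"] by (auto intro: below_closed)
  finally show ?case by simp
qed

lemma ann_below:
  assumes "0 \<le> n" "v \<in> below (Suc d)"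
  shows "nprod W (g i) n v \<in> below d"
  using assms(2)
proof (induction rule: below_induct)
  case (fm M)
  then show ?case using ann_fm_below[OF assms(1), of i M] below_mono[of "size M" d] by auto
qed (auto simp: nprod_simps intro: below_closed)

lemma ann_below': "0 \<le> n \<Longrightarrow> v \<in> below d \<Longrightarrow> nprod W (g i) n v \<in> below d"
  using ann_below[of n v d i] below_mono[of d "Suc d"] by auto

lemma mode_below: "v \<in> below d \<Longrightarrow> nprod W (g i) n v \<in> below (Suc d)"
proof (cases "0 \<le> n")
  case True
  then show "v \<in> below d \<Longrightarrow> ?thesis" using ann_below'[of n v d i] below_mono[of d "Suc d"] by auto
next
  case False
  then have "nprod W (g i) n = crea i (nat (- 1 - n))" by (simp add: crea_def)
  then show "v \<in> below d \<Longrightarrow> ?thesis" by (simp add: crea_below)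
qed

end

text \<open>The linear differential equation of the loop algebra element given by the series
  \<open>C\<close>, written coordinatewise. A different \<open>C\<close> may be taken at each time
  \<open>s\<close>, as the torus flow requires.\<close>

definition integral_curve ::
  "('i \<Rightarrow> complex) \<Rightarrow> ('i \<Rightarrow> 'i) \<Rightarrow> (complex \<Rightarrow> 'i \<Rightarrow> complex fps) \<Rightarrow> complex fps \<Rightarrow> complex \<Rightarrow> bool" where
  "integral_curve c \<tau> p C s \<longleftrightarrow> (\<forall>i k. ((\<lambda>s. fps_nth (p s i) k) has_field_derivative
     c i * fps_nth (C * p s (\<tau> i)) k) (at s))"

text \<open>One scalar and one target per generator are enough, because each of \<open>e\<close>,
  \<open>f\<close>, \<open>h\<close> sends every basis vector of the adjoint and coadjoint
  representations to a multiple of a basis vector.\<close>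

locale fock_current = fock_space W g \<eta>
  for W :: "'w::ab_group_add vertex_alg" and g :: "'i \<Rightarrow> 'w" and \<eta> :: "'i \<Rightarrow> 'i \<Rightarrow> complex" +
  fixes \<theta> :: 'w and c :: "'i \<Rightarrow> complex" and \<tau> :: "'i \<Rightarrow> 'i"
  assumes current_ope: "n \<ge> 0 \<Longrightarrow> nprod W \<theta> n (g i) = (if n = 0 then vscale W (c i) (g (\<tau> i)) else 0)"
begin

lemma current_commute:
  "nprod W \<theta> m (nprod W (g i) k w)
     = nprod W (g i) k (nprod W \<theta> m w) + vscale W (c i) (nprod W (g (\<tau> i)) (m + k) w)"
  using nprod_commutator_simple_pole[of \<theta> "g i" m k w] by (simp add: current_ope nprod_scale_left)

lemma current_fm_below: "0 \<le> n \<Longrightarrow> nprod W \<theta> n (fm M) \<in> below (Suc (size M))"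
proof (induction M)
  case empty
  then show ?case by (simp add: fm_empty creation_regular below_closed)
next
  case (add x M)
  obtain i k where x: "x = (i, k)" by force
  have "nprod W \<theta> n (fm (add_mset x M)) = crea i k (nprod W \<theta> n (fm M))
      + vscale W (c i) (nprod W (g (\<tau> i)) (n + (- 1 - int k)) (fm M))"
    unfolding x fm_add crea_def by (rule current_commute)
  also have "\<dots> \<in> below (Suc (Suc (size M)))"
    by (intro below_closed crea_below add mode_below fm_below) simp
  finally show ?case by simp
qed

lemma current_below:
  assumes "0 \<le> n" "v \<in> below d"
  shows "nprod W \<theta> n v \<in> below d"
  using assms(2)
proof (induction rule: below_induct)
  case (fm M)
  then show ?case using current_fm_below[OF assms(1), of M] below_mono[of "Suc (size M)" d] by auto
qed (auto simp: nprod_simps intro: below_closed)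

text \<open>
  The part of \<open>\<theta>(n)\<close> that preserves the degree is a derivation of the polynomial algebra: the vector
  field \<open>t\<^sup>n \<theta>\<close> on the space of arcs. Hence \<open>ev v\<close> is differentiated along integral curves of
  time-dependent combinations of these vector fields.
\<close>

lemma derivative_fm:
  "\<exists>N0. \<forall>N\<ge>N0. \<forall>p C s. integral_curve c \<tau> p C s \<longrightarrow>
     ((\<lambda>s. ev (fm M) (p s)) has_field_derivative
       (\<Sum>n\<le>N. fps_nth C n * ev (pr (size M) (nprod W \<theta> (int n) (fm M))) (p s))) (at s)"
proof (induction M)
  case empty
  show ?case by (simp add: fm_empty ev_vacuum creation_regular pr_linear ev_linear)
next
  case (add x M)
  obtain i k where x: "x = (i, k)" by force
  from add.IH obtain N0 where N0: "\<And>N p C s. N0 \<le> N \<Longrightarrow> integral_curve c \<tau> p C s \<Longrightarrow>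
     ((\<lambda>s. ev (fm M) (p s)) has_field_derivative
       (\<Sum>n\<le>N. fps_nth C n * ev (pr (size M) (nprod W \<theta> (int n) (fm M))) (p s))) (at s)" by blast
  \<comment> \<open>The current shifts the mode \<open>-1-k\<close> to \<open>n-1-k\<close>. For
    \<open>n \<le> k\<close> this is still a creation operator; otherwise it is an annihilator,
    which lowers the degree and is lost under the projection. The truncation is that of multiplying
    an arc by \<open>t^n\<close>.\<close>
  have D: "pr (Suc (size M)) (nprod W \<theta> (int n) (fm (add_mset x M)))
      = crea i k (pr (size M) (nprod W \<theta> (int n) (fm M)))
        + (if n \<le> k then vscale W (c i) (crea (\<tau> i) (k - n) (fm M)) else 0)" for n
  proof -
    have "nprod W \<theta> (int n) (fm (add_mset x M)) = crea i k (nprod W \<theta> (int n) (fm M))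
      + vscale W (c i) (nprod W (g (\<tau> i)) (int n + (- 1 - int k)) (fm M))"
      unfolding x fm_add crea_def by (rule current_commute)
    moreover have "pr (Suc (size M)) (nprod W (g (\<tau> i)) (int n + (- 1 - int k)) (fm M))
        = (if n \<le> k then crea (\<tau> i) (k - n) (fm M) else 0)"
    proof (cases "n \<le> k")
      case True
      then have "nprod W (g (\<tau> i)) (int n + (- 1 - int k)) (fm M) = crea (\<tau> i) (k - n) (fm M)"
        by (simp add: crea_def of_nat_diff algebra_simps)
      then show ?thesis using True by (simp add: pr_crea pr_fm)
    next
      case False
      then have "0 \<le> int n + (- 1 - int k)" by simp
      from pr_below[OF ann_fm_below[OF this]] False show ?thesis by simp
    qed
    ultimately show ?thesis by (simp add: pr_linear pr_crea)
  qed
  show ?case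
  proof (intro exI[of _ "max N0 k"] allI impI)
    fix N p C s assume N: "max N0 k \<le> N" and p: "integral_curve c \<tau> p C s"
    have "(\<Sum>n\<le>N. if n \<le> k then fps_nth C n * fps_nth (p s (\<tau> i)) (k - n) else 0)
        = (\<Sum>n\<in>{0..k}. fps_nth C n * fps_nth (p s (\<tau> i)) (k - n))"
      by (rule sum.mono_neutral_cong_right) (use N in auto)
    then have C: "fps_nth (C * p s (\<tau> i)) k = (\<Sum>n\<le>N. if n \<le> k then fps_nth C n * fps_nth (p s (\<tau> i)) (k - n) else 0)"
      by (simp add: fps_mult_nth)
    have "((\<lambda>s. fps_nth (p s i) k * ev (fm M) (p s)) has_field_derivative
        c i * fps_nth (C * p s (\<tau> i)) k * ev (fm M) (p s)
        + (\<Sum>n\<le>N. fps_nth C n * ev (pr (size M) (nprod W \<theta> (int n) (fm M))) (p s)) * fps_nth (p s i) k) (at s)"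
      by (rule DERIV_mult) (use p N0[of N p C s] N in \<open>auto simp: integral_curve_def\<close>)
    also have "(\<lambda>s. fps_nth (p s i) k * ev (fm M) (p s)) = (\<lambda>s. ev (fm (add_mset x M)) (p s))"
      by (simp add: x fm_add ev_crea)
    also have "c i * fps_nth (C * p s (\<tau> i)) k * ev (fm M) (p s)
        + (\<Sum>n\<le>N. fps_nth C n * ev (pr (size M) (nprod W \<theta> (int n) (fm M))) (p s)) * fps_nth (p s i) k
      = (\<Sum>n\<le>N. fps_nth C n * ev (pr (Suc (size M)) (nprod W \<theta> (int n) (fm (add_mset x M)))) (p s))"
      unfolding C D sum_distrib_left sum_distrib_right sum.distrib[symmetric]
      by (rule sum.cong) (auto simp: ev_linear ev_crea algebra_simps)
    finally show "((\<lambda>s. ev (fm (add_mset x M)) (p s)) has_field_derivative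
        (\<Sum>n\<le>N. fps_nth C n * ev (pr (size (add_mset x M)) (nprod W \<theta> (int n) (fm (add_mset x M)))) (p s))) (at s)"
      by simp
  qed
qed

text \<open>A claim about all large \<open>N\<close>, rather than one \<open>N\<close>, survives
  sums: the bounds of the two summands are replaced by their maximum.\<close>

lemma derivative_homogeneous:
  assumes "v \<in> below (Suc d)"
  shows "\<exists>N0. \<forall>N\<ge>N0. \<forall>p C s. integral_curve c \<tau> p C s \<longrightarrow>
     ((\<lambda>s. ev (pr d v) (p s)) has_field_derivative
       (\<Sum>n\<le>N. fps_nth C n * ev (pr d (nprod W \<theta> (int n) (pr d v))) (p s))) (at s)"
  using assms
proof (induction rule: below_induct)
  case zero
  show ?case by (simp add: pr_linear ev_linear nprod_simps)
next
  case (fm M)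
  then show ?case using derivative_fm[of M]
    by (auto simp: pr_fm pr_linear ev_linear nprod_simps)
next
  case (add v w)
  then obtain N1 N2 where N: "\<And>N p C s. N1 \<le> N \<Longrightarrow> integral_curve c \<tau> p C s \<Longrightarrow>
     ((\<lambda>s. ev (pr d v) (p s)) has_field_derivative
       (\<Sum>n\<le>N. fps_nth C n * ev (pr d (nprod W \<theta> (int n) (pr d v))) (p s))) (at s)"
     "\<And>N p C s. N2 \<le> N \<Longrightarrow> integral_curve c \<tau> p C s \<Longrightarrow>
     ((\<lambda>s. ev (pr d w) (p s)) has_field_derivative
       (\<Sum>n\<le>N. fps_nth C n * ev (pr d (nprod W \<theta> (int n) (pr d w))) (p s))) (at s)" by blast
  show ?case
  proof (intro exI[of _ "max N1 N2"] allI impI)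
    fix N p C s assume "max N1 N2 \<le> N" "integral_curve c \<tau> p C s"
    from DERIV_add[OF N(1)[of N, OF _ this(2)] N(2)[of N, OF _ this(2)]] this(1)
    show "((\<lambda>s. ev (pr d (v + w)) (p s)) has_field_derivative
       (\<Sum>n\<le>N. fps_nth C n * ev (pr d (nprod W \<theta> (int n) (pr d (v + w)))) (p s))) (at s)"
      by (simp add: pr_linear ev_linear nprod_simps algebra_simps sum.distrib)
  qed
next
  case (scale a v)
  then obtain N1 where N: "\<And>N p C s. N1 \<le> N \<Longrightarrow> integral_curve c \<tau> p C s \<Longrightarrow>
     ((\<lambda>s. ev (pr d v) (p s)) has_field_derivative
       (\<Sum>n\<le>N. fps_nth C n * ev (pr d (nprod W \<theta> (int n) (pr d v))) (p s))) (at s)" by blast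
  show ?case
  proof (intro exI[of _ N1] allI impI)
    fix N p C s assume "N1 \<le> N" "integral_curve c \<tau> p C s"
    from DERIV_cmult[OF N[OF this], of a]
    show "((\<lambda>s. ev (pr d (vscale W a v)) (p s)) has_field_derivative
       (\<Sum>n\<le>N. fps_nth C n * ev (pr d (nprod W \<theta> (int n) (pr d (vscale W a v)))) (p s))) (at s)"
      by (simp add: pr_linear ev_linear nprod_simps sum_distrib_left mult.left_commute)
  qed
qed

text \<open>The modes of \<open>\<theta>\<close> preserve the filtration, so in degree
  \<open>d\<close> the equation \<open>nprod W \<theta> n v = 0\<close> only sees the leading part.
  All terms of the derivative along the curve therefore vanish.\<close>

lemma leading_part_invariant:
  assumes v: "v \<in> below (Suc d)" and kill: "\<And>n. 0 \<le> n \<Longrightarrow> nprod W \<theta> n v = 0"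
    and curve: "\<And>s. integral_curve c \<tau> p (C s) s"
  shows "ev (pr d v) (p s) = ev (pr d v) (p s')"
proof -
  have "pr d (nprod W \<theta> n (pr d v)) = 0" if "0 \<le> n" for n
  proof -
    have "nprod W \<theta> n (v - pr d v) \<in> below d"
      by (rule current_below[OF that diff_pr_below[OF v]])
    then have "pr d (nprod W \<theta> n (v - pr d v)) = 0" by (simp add: pr_below)
    then have "pr d (nprod W \<theta> n v) - pr d (nprod W \<theta> n (pr d v)) = 0"
      by (simp only: nprod_diff_right pr_linear)
    then show ?thesis by (simp add: pr_linear kill[OF that])
  qed
  then have "((\<lambda>s. ev (pr d v) (p s)) has_field_derivative 0) (at s)" for s
    using derivative_homogeneous[OF v] curve[of s] by (auto simp: ev_linear)
  then show ?thesis
    using has_field_derivative_zero_constant[of UNIV "\<lambda>s. ev (pr d v) (p s)"] by auto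
qed

end

section \<open>Integral curves\<close>

definition has_fps_path_derivative ::
  "(complex \<Rightarrow> complex fps) \<Rightarrow> complex fps \<Rightarrow> complex \<Rightarrow> bool" where
  "has_fps_path_derivative a a' s \<longleftrightarrow>
     (\<forall>k. ((\<lambda>s. fps_nth (a s) k) has_field_derivative fps_nth a' k) (at s))"

text \<open>Enough for both unipotent flows, which are quadratic in time because the cubes of ad
  \<open>e\<close> and ad \<open>f\<close> vanish.\<close>

lemma fps_path_quadratic:
  "has_fps_path_derivative (\<lambda>s. a + fps_const s * b + fps_const (s ^ 2) * e)
     (b + fps_const (2 * s) * e) s"
  by (auto simp: has_fps_path_derivative_def intro!: derivative_eq_intros)

lemma fps_path_mult:
  assumes "has_fps_path_derivative a a' s" "has_fps_path_derivative b b' s"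
  shows "has_fps_path_derivative (\<lambda>s. a s * b s) (a' * b s + a s * b') s"
  unfolding has_fps_path_derivative_def
proof
  fix k
  have "((\<lambda>s. \<Sum>i=0..k. fps_nth (a s) i * fps_nth (b s) (k - i)) has_field_derivative
      (\<Sum>i=0..k. fps_nth a' i * fps_nth (b s) (k - i) + fps_nth b' (k - i) * fps_nth (a s) i)) (at s)"
    by (intro DERIV_sum DERIV_mult) (use assms in \<open>auto simp: has_fps_path_derivative_def\<close>)
  then show "((\<lambda>s. fps_nth (a s * b s) k) has_field_derivative fps_nth (a' * b s + a s * b') k) (at s)"
    by (simp add: fps_mult_nth sum.distrib mult.commute[of "fps_nth b' _"])
qed

lemma fps_path_const: "has_fps_path_derivative (\<lambda>_. a) 0 s"
  by (simp add: has_fps_path_derivative_def)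

text \<open>Coefficient by coefficient along the recursion for the inverse: the expected derivative
  \<open>d\<close> satisfies the differentiated recursion because
  \<open>a s * d + a' * inverse (a s) = 0\<close>.\<close>

lemma fps_path_inverse:
  assumes a0: "\<And>s. fps_nth (a s) 0 \<noteq> 0" and a: "has_fps_path_derivative a a' s"
  shows "has_fps_path_derivative (\<lambda>s. inverse (a s)) (- a' * inverse (a s) ^ 2) s"
proof -
  define d where "d = - a' * inverse (a s) ^ 2"
  have "a s * d = - (a s * inverse (a s)) * (a' * inverse (a s))"
    by (simp only: d_def power2_eq_square mult_minus_left mult_minus_right mult_ac)
  then have zero: "a s * d + a' * inverse (a s) = 0"
    by (simp only: fps_mult_inverse[OF a0[of s]]) simp
  have "((\<lambda>s. fps_nth (inverse (a s)) k) has_field_derivative fps_nth d k) (at s)" for k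
  proof (induction k rule: less_induct)
    case (less k)
    have a'0: "((\<lambda>s. fps_nth (a s) 0) has_field_derivative fps_nth a' 0) (at s)"
      using a by (simp add: has_fps_path_derivative_def)
    have inv0: "((\<lambda>s. inverse (fps_nth (a s) 0)) has_field_derivative
        - (inverse (fps_nth (a s) 0) * fps_nth a' 0 * inverse (fps_nth (a s) 0))) (at s)"
      by (rule DERIV_inverse'[OF a'0 a0])
    show ?case
    proof (cases "k = 0")
      case True
      then show ?thesis using inv0 by (simp add: d_def power2_eq_square mult_ac)
    next
      case False
      define I where "I s = inverse (a s)" for s
      let ?S = "\<lambda>s. \<Sum>i=1..k. fps_nth (a s) i * fps_nth (I s) (k - i)"
      let ?S' = "\<Sum>i=1..k. fps_nth a' i * fps_nth (I s) (k - i) + fps_nth d (k - i) * fps_nth (a s) i"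
      have I: "fps_nth (I s) k = - (inverse (fps_nth (a s) 0) * ?S s)" for s
        using False by (cases k) (simp_all add: I_def fps_inverse_def)
      have S: "(?S has_field_derivative ?S') (at s)"
        by (intro DERIV_sum DERIV_mult) (use a less in \<open>auto simp: has_fps_path_derivative_def I_def\<close>)
      have split: "(\<Sum>i=0..k. f i) = f 0 + (\<Sum>i=1..k. f i)" for f :: "nat \<Rightarrow> complex"
        by (simp add: sum.atLeast_Suc_atMost)
      have "0 = fps_nth (a s * d + a' * I s) k" by (simp only: zero I_def fps_zero_nth)
      also have "\<dots> = fps_nth (a s) 0 * fps_nth d k + fps_nth a' 0 * fps_nth (I s) k + ?S'"
        by (simp only: fps_add_nth fps_mult_nth split sum.distrib) (simp add: mult.commute)
      finally have dk: "fps_nth d k = - (inverse (fps_nth (a s) 0) * (fps_nth a' 0 * fps_nth (I s) k + ?S'))"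
        using a0[of s] by (simp add: field_simps add_eq_0_iff)
      have "((\<lambda>s. fps_nth (I s) k) has_field_derivative
          - (- (inverse (fps_nth (a s) 0) * fps_nth a' 0 * inverse (fps_nth (a s) 0)) * ?S s
             + ?S' * inverse (fps_nth (a s) 0))) (at s)"
        unfolding I by (rule DERIV_minus[OF DERIV_mult[OF inv0 S]])
      also have "- (- (inverse (fps_nth (a s) 0) * fps_nth a' 0 * inverse (fps_nth (a s) 0)) * ?S s
             + ?S' * inverse (fps_nth (a s) 0)) = fps_nth d k"
        unfolding dk I by (simp add: algebra_simps)
      finally show ?thesis by (simp add: I_def)
    qed
  qed
  then show ?thesis by (simp add: has_fps_path_derivative_def d_def)
qed

lemma integral_curve_iff:
  "integral_curve c \<tau> p C s \<longleftrightarrow>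
     (\<forall>i. has_fps_path_derivative (\<lambda>s. p s i) (fps_const (c i) * (C * p s (\<tau> i))) s)"
  by (simp add: integral_curve_def has_fps_path_derivative_def)

text \<open>The first-order poles of the three currents with the generators. Where a coefficient is
  \<open>0\<close>, the target is a dummy, namely the generator itself.\<close>

abbreviation (input) "coef_e \<equiv> pt 0 1 (-2) 2 0 (-1) :: gen \<Rightarrow> complex"
abbreviation (input) "coef_f \<equiv> pt (-1) 0 2 0 (-2) 1 :: gen \<Rightarrow> complex"
abbreviation (input) "coef_h \<equiv> pt 2 (-2) 0 (-2) 2 0 :: gen \<Rightarrow> complex"
abbreviation (input) "target_e \<equiv> pt Xe Xh Xe Yh Yf Yf"
abbreviation (input) "target_f \<equiv> pt Xh Xf Xf Ye Yh Ye"

lemma fps_path_quadraticI: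
  assumes "\<And>s. p s = a + fps_const s * b + fps_const (s ^ 2) * e" "p' = b + fps_const (2 * s) * e"
  shows "has_fps_path_derivative p p' s"
  using fps_path_quadratic[of a b e s] unfolding assms(2) assms(1)[abs_def] .

lemma integral_curve_flow_e:
  "integral_curve coef_e target_e (\<lambda>s. flow_e (fps_const s * c) x) c s"
  unfolding integral_curve_iff
proof
  fix i
  show "has_fps_path_derivative (\<lambda>s. flow_e (fps_const s * c) x i)
      (fps_const (coef_e i) * (c * flow_e (fps_const s * c) x (target_e i))) s"
  proof (cases i)
    case Xe
    show ?thesis
      by (rule fps_path_quadraticI[where a = "x Xe" and b = 0 and e = 0]) (simp_all add: Xe flow_e_def)
  next
    case Xf
    show ?thesis
      by (rule fps_path_quadraticI[where a = "x Xf" and b = "c * x Xh" and e = "- (c ^ 2) * x Xe"])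
        (simp_all add: Xf flow_e_def algebra_simps power2_eq_square
          flip: fps_const_mult fps_const_neg numeral_fps_const)
  next
    case Xh
    show ?thesis
      by (rule fps_path_quadraticI[where a = "x Xh" and b = "- 2 * c * x Xe" and e = 0])
        (simp_all add: Xh flow_e_def algebra_simps
          flip: fps_const_mult fps_const_neg numeral_fps_const)
  next
    case Ye
    show ?thesis
      by (rule fps_path_quadraticI[where a = "x Ye" and b = "2 * c * x Yh" and e = "- (c ^ 2) * x Yf"])
        (simp_all add: Ye flow_e_def algebra_simps power2_eq_square
          flip: fps_const_mult fps_const_neg numeral_fps_const)
  next
    case Yf
    show ?thesis
      by (rule fps_path_quadraticI[where a = "x Yf" and b = 0 and e = 0]) (simp_all add: Yf flow_e_def)
  next
    case Yh
    show ?thesis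
      by (rule fps_path_quadraticI[where a = "x Yh" and b = "- c * x Yf" and e = 0])
        (simp_all add: Yh flow_e_def algebra_simps
          flip: fps_const_mult fps_const_neg numeral_fps_const)
  qed
qed

lemma integral_curve_flow_f:
  "integral_curve coef_f target_f (\<lambda>s. flow_f (fps_const s * c) x) c s"
  unfolding integral_curve_iff
proof
  fix i
  show "has_fps_path_derivative (\<lambda>s. flow_f (fps_const s * c) x i)
      (fps_const (coef_f i) * (c * flow_f (fps_const s * c) x (target_f i))) s"
  proof (cases i)
    case Xe
    show ?thesis
      by (rule fps_path_quadraticI[where a = "x Xe" and b = "- c * x Xh" and e = "- (c ^ 2) * x Xf"])
        (simp_all add: Xe flow_f_def algebra_simps power2_eq_square
          flip: fps_const_mult fps_const_neg numeral_fps_const)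
  next
    case Xf
    show ?thesis
      by (rule fps_path_quadraticI[where a = "x Xf" and b = 0 and e = 0]) (simp_all add: Xf flow_f_def)
  next
    case Xh
    show ?thesis
      by (rule fps_path_quadraticI[where a = "x Xh" and b = "2 * c * x Xf" and e = 0])
        (simp_all add: Xh flow_f_def algebra_simps
          flip: fps_const_mult fps_const_neg numeral_fps_const)
  next
    case Ye
    show ?thesis
      by (rule fps_path_quadraticI[where a = "x Ye" and b = 0 and e = 0]) (simp_all add: Ye flow_f_def)
  next
    case Yf
    show ?thesis
      by (rule fps_path_quadraticI[where a = "x Yf" and b = "- 2 * c * x Yh" and e = "- (c ^ 2) * x Ye"])
        (simp_all add: Yf flow_f_def algebra_simps power2_eq_square
          flip: fps_const_mult fps_const_neg numeral_fps_const)
  next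
    case Yh
    show ?thesis
      by (rule fps_path_quadraticI[where a = "x Yh" and b = "c * x Ye" and e = 0])
        (simp_all add: Yh flow_f_def algebra_simps
          flip: fps_const_mult fps_const_neg numeral_fps_const)
  qed
qed

text \<open>The required loop algebra element is half the logarithmic derivative of the path
  \<open>l\<close>; the half compensates for the weights \<open>2\<close> and \<open>-2\<close> of
  \<open>h\<close>.\<close>

lemma integral_curve_flow_h:
  assumes l0: "\<And>s. fps_nth (l s) 0 \<noteq> 0" and l: "has_fps_path_derivative l l' s"
  shows "integral_curve coef_h (\<lambda>i. i) (\<lambda>s. flow_h (l s) x) (fps_const (1/2) * l' * inverse (l s)) s"
  unfolding integral_curve_iff
proof
  fix i
  have ll: "l s * inverse (l s) = 1" by (rule fps_mult_inverse[OF l0])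
  have two: "fps_const 2 * fps_const (1/2) = (1 :: complex fps)" by simp
  have L: "has_fps_path_derivative (\<lambda>s. l s * a)
      (fps_const 2 * (fps_const (1/2) * l' * inverse (l s) * (l s * a))) s" for a
  proof -
    have "fps_const 2 * (fps_const (1/2) * l' * inverse (l s) * (l s * a))
        = (fps_const 2 * fps_const (1/2)) * (l s * inverse (l s)) * (l' * a)"
      by (simp only: mult_ac)
    also have "\<dots> = l' * a + l s * 0" by (simp only: ll two mult_1_left mult_zero_right add_0_right)
    finally show ?thesis by (simp only: fps_path_mult[OF l fps_path_const[of a]])
  qed
  have I: "has_fps_path_derivative (\<lambda>s. inverse (l s) * a)
      (fps_const (- 2) * (fps_const (1/2) * l' * inverse (l s) * (inverse (l s) * a))) s" for a
  proof -
    have "fps_const (- 2) * (fps_const (1/2) * l' * inverse (l s) * (inverse (l s) * a))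
        = - ((fps_const 2 * fps_const (1/2)) * (l' * inverse (l s) ^ 2 * a))"
      by (simp only: mult_ac power2_eq_square fps_const_neg[symmetric] mult_minus_left mult_minus_right)
    also have "\<dots> = - l' * inverse (l s) ^ 2 * a + inverse (l s) * 0"
      by (simp only: two mult_1_left mult_zero_right add_0_right mult_minus_left)
    finally show ?thesis by (simp only: fps_path_mult[OF fps_path_inverse[OF l0 l] fps_path_const[of a]])
  qed
  show "has_fps_path_derivative (\<lambda>s. flow_h (l s) x i)
      (fps_const (coef_h i) * (fps_const (1/2) * l' * inverse (l s) * flow_h (l s) x i)) s"
    using L I by (cases i) (simp_all add: flow_h_def fps_path_const)
qed

text \<open>A straight path from \<open>1\<close> to \<open>l\<close> could lose invertibility at
  some complex time. Hence the constant term moves along an exponential, and only the remaining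
  factor, whose constant term stays \<open>1\<close>, moves linearly.\<close>

lemma path_to_unit:
  fixes l :: "complex fps"
  assumes l0: "fps_nth l 0 \<noteq> 0"
  obtains \<Lambda> \<Lambda>' where "\<Lambda> 0 = 1" "\<Lambda> 1 = l" "\<And>s. fps_nth (\<Lambda> s) 0 \<noteq> 0"
    "\<And>s. has_fps_path_derivative \<Lambda> (\<Lambda>' s) s"
proof -
  define a where "a = ln (fps_nth l 0)"
  have a: "exp a = fps_nth l 0" using l0 by (simp add: a_def)
  define m where "m = fps_const (inverse (fps_nth l 0)) * l - 1"
  have m0: "fps_nth m 0 = 0" using l0 by (simp add: m_def)
  let ?L = "\<lambda>s. fps_const (exp (s * a)) * (1 + fps_const s * m + fps_const (s ^ 2) * 0)"
  have e: "has_fps_path_derivative (\<lambda>s. fps_const (exp (s * a))) (fps_const (a * exp (s * a))) s" for s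
    by (auto simp: has_fps_path_derivative_def intro!: derivative_eq_intros)
  show ?thesis
  proof
    show "?L 0 = 1" by simp
    have "?L 1 = (fps_const (fps_nth l 0) * fps_const (inverse (fps_nth l 0))) * l"
      by (simp add: a m_def)
    then show "?L 1 = l" using l0 by simp
    show "fps_nth (?L s) 0 \<noteq> 0" for s using m0 by simp
    show "has_fps_path_derivative ?L (fps_const (a * exp (s * a)) * (1 + fps_const s * m + fps_const (s ^ 2) * 0)
        + fps_const (exp (s * a)) * (m + fps_const (2 * s) * 0)) s" for s
      by (rule fps_path_mult[OF e fps_path_quadratic])
  qed
qed

section \<open>The commutant of the currents\<close>

context fock_space
begin

text \<open>The part of the mode \<open>-1-k\<close> of \<open>:g i g j:\<close> that consists of
  creation operators only; it corresponds to the coefficient of \<open>t^k\<close> in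
  \<open>p i * p j\<close>.\<close>

primrec quad_crea_pair :: "nat \<Rightarrow> 'i \<times> 'i \<Rightarrow> 'w \<Rightarrow> 'w" where
  "quad_crea_pair k (i, j) v = (\<Sum>a\<le>k. crea i a (crea j (k - a) v))"

lemma ev_quad_crea_pair:
  "ev (quad_crea_pair k (i, j) v) p = fps_nth (p i * p j) k * ev v p"
  by (simp add: ev_sum ev_crea fps_mult_nth atLeast0AtMost sum_distrib_right mult.assoc)

lemma pr_sum: "pr d (sum f A) = (\<Sum>a\<in>A. pr d (f a))"
  by (induction A rule: infinite_finite_induct) (simp_all add: pr_linear)

lemma quad_crea_pair_below: "v \<in> below d \<Longrightarrow> quad_crea_pair k (i, j) v \<in> below (Suc (Suc d))"
  by (simp add: below_closed crea_below)

text \<open>Each remaining summand applies a non-negative mode first, which lowers the degree, and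
  then one more mode, which raises it by at most one.\<close>

lemma wick_mode_below:
  assumes w: "w \<in> below (Suc d)"
  shows "nprod W (wick W (g i) (g j)) (- 1 - int k) w - quad_crea_pair k (i, j) w \<in> below (Suc d)"
proof -
  obtain N1 where N1: "\<And>n. N1 \<le> n \<Longrightarrow> nprod W (g j) n w = 0" using truncation by blast
  obtain N2 where N2: "\<And>n. N2 \<le> n \<Longrightarrow> nprod W (g i) n w = 0" using truncation by blast
  define J where "J = Suc (k + k) + nat \<bar>N1\<bar> + nat \<bar>N2\<bar>"
  let ?f = "\<lambda>a. nprod W (g i) (- 1 - int a) (nprod W (g j) (- 1 - int k + int a) w)"
  let ?r = "\<lambda>a. nprod W (g j) (- 1 - int k - 1 - int a) (nprod W (g i) (int a) w)"
  have "nprod W (wick W (g i) (g j)) (- 1 - int k) w = (\<Sum>a<J. ?f a + ?r a)"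
  proof (rule wick_mode)
    show "nprod W (g j) (- 1 - int k + int a) w = 0" if "J \<le> a" for a
      by (rule N1) (use that in \<open>simp add: J_def\<close>)
    show "nprod W (g i) (int a) w = 0" if "J \<le> a" for a
      by (rule N2) (use that in \<open>simp add: J_def\<close>)
  qed
  also have "\<dots> = sum ?f {..<J} + sum ?r {..<J}" by (rule sum.distrib)
  also have "{..<J} = {..k} \<union> {Suc k..<J}" by (auto simp: J_def)
  also have "sum ?f ({..k} \<union> {Suc k..<J}) = sum ?f {..k} + sum ?f {Suc k..<J}"
    by (rule sum.union_disjoint) auto
  also have "sum ?f {..k} = quad_crea_pair k (i, j) w"
    by (simp add: crea_def of_nat_diff algebra_simps)
  finally have "nprod W (wick W (g i) (g j)) (- 1 - int k) w - quad_crea_pair k (i, j) w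
      = sum ?f {Suc k..<J} + sum ?r ({..k} \<union> {Suc k..<J})" by simp
  also have "\<dots> \<in> below (Suc d)"
    by (intro below_closed mode_below ann_below w) auto
  finally show ?thesis .
qed

lemma wick_generators_commute: "wick W (g i) (g j) = wick W (g j) (g i)"
proof -
  have "g i = crea i 0 (vacuum W)" for i by (simp add: crea_def creation)
  then have "wick W (g i) (g j) = crea i 0 (crea j 0 (vacuum W))" for i j
    by (metis crea_def diff_zero of_nat_0 wick_def)
  then show ?thesis using crea_commute by metis
qed

end

text \<open>The mode \<open>0\<close> acts as a derivation; the only further term is the double
  contraction at \<open>n = 1\<close>.\<close>

lemma (in fock_current) current_wick:
  assumes "0 \<le> n"
  shows "nprod W \<theta> n (wick W (g i) (g j)) =
    (if n = 0 then vscale W (c j) (wick W (g i) (g (\<tau> j))) + vscale W (c i) (wick W (g (\<tau> i)) (g j))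
     else if n = 1 then vscale W (c i * \<eta> (\<tau> i) j) (vacuum W) else 0)"
  using current_commute[of n i "-1" "g j"] assms current_ope[of n j] ope[of "n - 1" "\<tau> i" j]
  by (auto simp: wick_def nprod_simps)

text \<open>Antisymmetric because the fields are even: exchanging them changes the sign of a simple
  pole.\<close>

definition pairing :: "gen \<Rightarrow> gen \<Rightarrow> complex" where
  "pairing i j = (if (i, j) \<in> {(Xe, Ye), (Xf, Yf), (Xh, Yh)} then 1
     else if (j, i) \<in> {(Xe, Ye), (Xf, Yf), (Xh, Yh)} then - 1 else 0)"

section \<open>Currents of the adjoint representation and their quadratic fields\<close>

locale sl2_fock = fock_space W g pairing
  for W :: "'w::ab_group_add vertex_alg" and g :: "gen \<Rightarrow> 'w" +
  fixes \<theta>e \<theta>f \<theta>h :: 'w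
  assumes current_e: "fock_current W g pairing \<theta>e coef_e target_e"
    and current_f: "fock_current W g pairing \<theta>f coef_f target_f"
    and current_h: "fock_current W g pairing \<theta>h coef_h (\<lambda>i. i)"
begin

abbreviation "Com \<equiv> commutant W {\<theta>e, \<theta>f, \<theta>h}"

lemma leading_part_flow_invariant:
  assumes v: "v \<in> below (Suc d)" "v \<in> Com"
  shows "flow_invariant (ev (pr d v))"
proof
  show "ev (pr d v) \<in> fun_alg coords" by (rule ev_polynomial)
next
  fix c p
  have "ev (pr d v) (flow_e (fps_const 1 * c) p) = ev (pr d v) (flow_e (fps_const 0 * c) p)"
    by (rule fock_current.leading_part_invariant[OF current_e v(1) _ integral_curve_flow_e])
      (use v(2) in \<open>simp add: commutant_def\<close>)
  then show "ev (pr d v) (flow_e c p) = ev (pr d v) p"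
    by (simp add: flow_e_def pt_eta)
next
  fix c p
  have "ev (pr d v) (flow_f (fps_const 1 * c) p) = ev (pr d v) (flow_f (fps_const 0 * c) p)"
    by (rule fock_current.leading_part_invariant[OF current_f v(1) _ integral_curve_flow_f])
      (use v(2) in \<open>simp add: commutant_def\<close>)
  then show "ev (pr d v) (flow_f c p) = ev (pr d v) p"
    by (simp add: flow_f_def pt_eta)
next
  fix l :: "complex fps" and p
  assume l: "fps_nth l 0 \<noteq> 0"
  obtain \<Lambda> \<Lambda>' where L: "\<Lambda> 0 = 1" "\<Lambda> 1 = l" "\<And>s. fps_nth (\<Lambda> s) 0 \<noteq> 0"
    "\<And>s. has_fps_path_derivative \<Lambda> (\<Lambda>' s) s" by (rule path_to_unit[OF l]) blast
  have "ev (pr d v) (flow_h (\<Lambda> 1) p) = ev (pr d v) (flow_h (\<Lambda> 0) p)"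
    by (rule fock_current.leading_part_invariant[OF current_h v(1) _ integral_curve_flow_h[OF L(3,4)]])
      (use v(2) in \<open>simp add: commutant_def\<close>)
  then show "ev (pr d v) (flow_h l p) = ev (pr d v) p"
    by (simp add: L flow_h_def pt_eta)
qed

primrec quad_field :: "quad \<Rightarrow> 'w" where
  "quad_field QF = wick W (g Xh) (g Xh) + vscale W 4 (wick W (g Xe) (g Xf))"
| "quad_field QE = wick W (g Yh) (g Yh) + wick W (g Ye) (g Yf)"
| "quad_field QH = wick W (g Xh) (g Yh) + wick W (g Xe) (g Ye) + wick W (g Xf) (g Yf)"

text \<open>The mode \<open>0\<close> vanishes because the quadratic forms are invariant. The double
  contractions vanish termwise for \<open>QF\<close> and \<open>QE\<close>, as two beta or two gamma
  fields do not contract; for \<open>QH\<close> they add up to the trace of the adjoint action,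
  which is zero.\<close>

lemma quad_field_in_Com: "quad_field q \<in> Com"
proof -
  note comm = wick_generators_commute[of Xh Xe] wick_generators_commute[of Xh Xf]
    wick_generators_commute[of Yh Ye] wick_generators_commute[of Yh Yf]
  have scale_numeral: "vscale W 2 x = x + x" "vscale W 4 x = (x + x) + (x + x)" for x
    using VS.scale_left_distrib[of 1 1 x] VS.scale_left_distrib[of 2 2 x] by simp_all
  have "nprod W \<theta>e n (quad_field q) = 0" if "0 \<le> n" for n
    by (cases q) (simp_all add: nprod_simps fock_current.current_wick[OF current_e that] pairing_def comm
      VS.scale_right_distrib scale_numeral algebra_simps)
  moreover have "nprod W \<theta>f n (quad_field q) = 0" if "0 \<le> n" for n
    by (cases q) (simp_all add: nprod_simps fock_current.current_wick[OF current_f that] pairing_def comm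
      VS.scale_right_distrib scale_numeral algebra_simps)
  moreover have "nprod W \<theta>h n (quad_field q) = 0" if "0 \<le> n" for n
    by (cases q) (simp_all add: nprod_simps fock_current.current_wick[OF current_h that] pairing_def comm
      VS.scale_right_distrib scale_numeral algebra_simps)
  ultimately show ?thesis by (auto simp: commutant_def)
qed

primrec quad_crea :: "quad \<Rightarrow> nat \<Rightarrow> 'w \<Rightarrow> 'w" where
  "quad_crea QF k v = quad_crea_pair k (Xh, Xh) v + vscale W 4 (quad_crea_pair k (Xe, Xf) v)"
| "quad_crea QE k v = quad_crea_pair k (Yh, Yh) v + quad_crea_pair k (Ye, Yf) v"
| "quad_crea QH k v = quad_crea_pair k (Xh, Yh) v + quad_crea_pair k (Xe, Ye) v + quad_crea_pair k (Xf, Yf) v"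

lemma ev_quad_crea: "ev (quad_crea q k v) p = fps_nth (quads p q) k * ev v p"
proof -
  have "fps_nth (4 * p Xe * p Xf) k = 4 * fps_nth (p Xe * p Xf) k"
    by (simp add: numeral_fps_const mult.assoc)
  then show ?thesis
    by (cases q) (simp_all add: ev_linear ev_quad_crea_pair distrib_right power2_eq_square
        del: quad_crea_pair.simps)
qed

lemma pr_quad_crea: "pr (Suc (Suc d)) (quad_crea q k v) = quad_crea q k (pr d v)"
  by (cases q) (simp_all add: pr_linear pr_sum pr_crea)

lemma pr_quad_crea_low: "d < 2 \<Longrightarrow> pr d (quad_crea q k v) = 0"
proof -
  assume "d < 2"
  then have "d = 0 \<or> d = Suc 0" by auto
  then show ?thesis
    by (cases q) (auto simp: pr_linear pr_sum pr_crea pr_zero_crea crea_simps)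
qed

lemma quad_field_mode:
  assumes w: "w \<in> below (Suc d)"
  shows "nprod W (quad_field q) (- 1 - int k) w - quad_crea q k w \<in> below (Suc d)"
proof (cases q)
  case QF
  have "nprod W (quad_field q) (- 1 - int k) w - quad_crea q k w =
      (nprod W (wick W (g Xh) (g Xh)) (- 1 - int k) w - quad_crea_pair k (Xh, Xh) w)
      + vscale W 4 (nprod W (wick W (g Xe) (g Xf)) (- 1 - int k) w - quad_crea_pair k (Xe, Xf) w)"
    by (simp add: QF nprod_simps VS.scale_right_diff_distrib del: quad_crea_pair.simps)
  also have "\<dots> \<in> below (Suc d)" by (intro below_closed wick_mode_below w)
  finally show ?thesis .
next
  case QE
  have "nprod W (quad_field q) (- 1 - int k) w - quad_crea q k w =
      (nprod W (wick W (g Yh) (g Yh)) (- 1 - int k) w - quad_crea_pair k (Yh, Yh) w)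
      + (nprod W (wick W (g Ye) (g Yf)) (- 1 - int k) w - quad_crea_pair k (Ye, Yf) w)"
    by (simp add: QE nprod_simps del: quad_crea_pair.simps)
  also have "\<dots> \<in> below (Suc d)" by (intro below_closed wick_mode_below w)
  finally show ?thesis .
next
  case QH
  have "nprod W (quad_field q) (- 1 - int k) w - quad_crea q k w =
      (nprod W (wick W (g Xh) (g Yh)) (- 1 - int k) w - quad_crea_pair k (Xh, Yh) w)
      + (nprod W (wick W (g Xe) (g Ye)) (- 1 - int k) w - quad_crea_pair k (Xe, Ye) w)
      + (nprod W (wick W (g Xf) (g Yf)) (- 1 - int k) w - quad_crea_pair k (Xf, Yf) w)"
    by (simp add: QH nprod_simps del: quad_crea_pair.simps)
  also have "\<dots> \<in> below (Suc d)" by (intro below_closed wick_mode_below w)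
  finally show ?thesis .
qed

lemma quad_crea_below: "v \<in> below d \<Longrightarrow> quad_crea q k v \<in> below (Suc (Suc d))"
  by (cases q) (auto intro!: below_closed quad_crea_pair_below simp del: quad_crea_pair.simps)

lemma quad_field_mode_below:
  assumes w: "w \<in> below (Suc d)"
  shows "nprod W (quad_field q) (- 1 - int k) w \<in> below (Suc (Suc (Suc d)))"
proof -
  have "nprod W (quad_field q) (- 1 - int k) w - quad_crea q k w \<in> below (Suc (Suc (Suc d)))"
    using quad_field_mode[OF w] below_mono[of "Suc d" "Suc (Suc (Suc d))"] by auto
  from below_closed(2)[OF this quad_crea_below[OF w, of q k]] show ?thesis by simp
qed

lemma pr_quad_field_mode:
  assumes w: "w \<in> below (Suc d)"
  shows "pr (Suc (Suc d)) (nprod W (quad_field q) (- 1 - int k) w) = quad_crea q k (pr d w)"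
  using pr_below[OF quad_field_mode[OF w], of "Suc (Suc d)" q k] by (simp add: pr_linear pr_quad_crea)

text \<open>The associated graded space of \<open>N\<close> inside the Fock space. A condition on
  every homogeneous component, rather than on homogeneous vectors only, admits inhomogeneous
  polynomials in the invariants.\<close>

definition symbols :: "'w set \<Rightarrow> 'w set" where
  "symbols N = {v. \<forall>d. \<exists>w\<in>N \<inter> below (Suc d). pr d v = pr d w}"

context
  fixes N :: "'w set"
  assumes sub: "VS.subspace N" and vac: "vacuum W \<in> N"
    and mode: "\<And>q k w. w \<in> N \<Longrightarrow> nprod W (quad_field q) (- 1 - int k) w \<in> N"
begin

lemma symbols_add:
  assumes "v \<in> symbols N" "w \<in> symbols N"
  shows "v + w \<in> symbols N"
  unfolding symbols_def mem_Collect_eq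
proof
  fix d
  obtain v' where v': "v' \<in> N" "v' \<in> below (Suc d)" "pr d v = pr d v'" using assms(1) by (auto simp: symbols_def)
  obtain w' where w': "w' \<in> N" "w' \<in> below (Suc d)" "pr d w = pr d w'" using assms(2) by (auto simp: symbols_def)
  show "\<exists>x\<in>N \<inter> below (Suc d). pr d (v + w) = pr d x"
    by (rule bexI[of _ "v' + w'"]) (use v' w' VS.subspace_add[OF sub] below_closed in \<open>auto simp: pr_linear\<close>)
qed

lemma symbols_scale:
  assumes "v \<in> symbols N"
  shows "vscale W c v \<in> symbols N"
  unfolding symbols_def mem_Collect_eq
proof
  fix d
  obtain v' where v': "v' \<in> N" "v' \<in> below (Suc d)" "pr d v = pr d v'" using assms(1) by (auto simp: symbols_def)
  show "\<exists>x\<in>N \<inter> below (Suc d). pr d (vscale W c v) = pr d x"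
    by (rule bexI[of _ "vscale W c v'"]) (use v' VS.subspace_scale[OF sub] below_closed in \<open>auto simp: pr_linear\<close>)
qed

lemma vacuum_in_symbols: "vacuum W \<in> symbols N"
  unfolding symbols_def mem_Collect_eq
proof
  fix d
  have "vacuum W \<in> below (Suc d)" using vacuum_below below_mono[of "Suc 0" "Suc d"] by auto
  then show "\<exists>x\<in>N \<inter> below (Suc d). pr d (vacuum W) = pr d x"
    using vac by auto
qed

lemma quad_crea_symbols:
  assumes v: "v \<in> symbols N"
  shows "quad_crea q k v \<in> symbols N"
  unfolding symbols_def mem_Collect_eq
proof
  fix d
  show "\<exists>x\<in>N \<inter> below (Suc d). pr d (quad_crea q k v) = pr d x"
  proof (cases "d < 2")
    case True
    then show ?thesis
      using VS.subspace_0[OF sub] below_closed(1) by (intro bexI[of _ 0]) (auto simp: pr_quad_crea_low pr_linear)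
  next
    case False
    define e where "e = d - 2"
    have d: "d = Suc (Suc e)" using False by (simp add: e_def)
    obtain w where w: "w \<in> N" "w \<in> below (Suc e)" "pr e v = pr e w" using v by (auto simp: symbols_def)
    show ?thesis unfolding d
      by (rule bexI[of _ "nprod W (quad_field q) (- 1 - int k) w"])
        (use w mode quad_field_mode_below in \<open>auto simp: pr_quad_crea pr_quad_field_mode\<close>)
  qed
qed

text \<open>Keeping \<open>v\<close> arbitrary makes the product case a composition: multiplication
  by the second factor, then by the first.\<close>

lemma polynomial_symbols:
  assumes "P \<in> fun_alg coords" "v \<in> symbols N"
  shows "\<exists>v'\<in>symbols N. \<forall>p. ev v' p = P (quads p) * ev v p"
  using assms
proof (induction arbitrary: v)
  case (const c)
  then show ?case by (intro bexI[OF _ symbols_scale[of v c]]) (auto simp: ev_linear)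
next
  case (gen f)
  then obtain q k where "f = (\<lambda>x. fps_nth (x q) k)" by (auto simp: coords_def)
  then show ?case using gen by (intro bexI[OF _ quad_crea_symbols[of v q k]]) (auto simp: ev_quad_crea)
next
  case (add f h)
  then obtain v' v'' where "v' \<in> symbols N" "v'' \<in> symbols N"
    "\<forall>p. ev v' p = f (quads p) * ev v p" "\<forall>p. ev v'' p = h (quads p) * ev v p" by blast
  then show ?case by (intro bexI[OF _ symbols_add[of v' v'']]) (auto simp: ev_linear algebra_simps)
next
  case (mult f h)
  then obtain v' where v': "v' \<in> symbols N" "\<forall>p. ev v' p = h (quads p) * ev v p" by blast
  from mult.IH(1)[OF v'(1)] obtain v'' where "v'' \<in> symbols N" "\<forall>p. ev v'' p = f (quads p) * ev v' p"
    by blast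
  then show ?case using v'(2) by (intro bexI[of _ v'']) auto
qed

lemma Com_subset:
  assumes N: "N \<subseteq> Com"
  shows "Com \<subseteq> N"
proof
  fix v assume v: "v \<in> Com"
  have "v \<in> Com \<Longrightarrow> v \<in> below d \<Longrightarrow> v \<in> N" for d
  proof (induction d arbitrary: v)
    case 0
    then show ?case using below_zero VS.subspace_0[OF sub] by auto
  next
    case (Suc d)
    interpret flow_invariant "ev (pr d v)"
      by (rule leading_part_flow_invariant[OF Suc.prems(2,1)])
    obtain P where P: "P \<in> fun_alg coords" "\<And>p. ev (pr d v) p = P (quads p)"
      by (rule factors_through_quads) blast
    obtain v' where v': "v' \<in> symbols N" "\<forall>p. ev v' p = P (quads p) * ev (vacuum W) p"
      using polynomial_symbols[OF P(1) vacuum_in_symbols] by blast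
    \<comment> \<open>The polynomial \<open>P\<close> need not be homogeneous: \<open>ev\<close> is
      injective, so \<open>v'\<close> is the leading part itself, and its component of degree
      \<open>d\<close> lifts to an element \<open>w\<close> of \<open>N\<close>. As \<open>N\<close>
      lies in \<open>Com\<close>, the difference \<open>v - w\<close> stays in the
      commutant.\<close>
    have "pr d v - v' = 0"
      by (rule ev_inject) (simp add: ev_linear P(2) v'(2) ev_vacuum)
    then have "pr d v \<in> symbols N" using v'(1) by simp
    then have "\<exists>w\<in>N \<inter> below (Suc d). pr d (pr d v) = pr d w"
      unfolding symbols_def by blast
    then obtain w where w: "w \<in> N" "w \<in> below (Suc d)" "pr d v = pr d w"
      by (auto simp: pr_pr)
    have "v - w - pr d (v - w) \<in> below d"
      by (intro diff_pr_below below_closed w Suc.prems)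
    then have "v - w \<in> below d" by (simp add: pr_linear w(3))
    moreover have "v - w \<in> Com"
      using VS.subspace_diff[OF subspace_commutant] Suc.prems(1) N w(1) by blast
    ultimately have "v - w \<in> N" by (rule Suc.IH[rotated])
    then show ?case using VS.subspace_add[OF sub _ w(1), of "v - w"] by simp
  qed
  then show "v \<in> N" using ex_below[of v] v by blast
qed

end

end

section \<open>Spans of normally ordered monomials\<close>

context vertex_algebra
begin

lemma wick_commutant:
  assumes "a \<in> commutant W U" "b \<in> commutant W U"
  shows "wick W a b \<in> commutant W U"
  unfolding wick_def by (rule commutant_nprod[OF assms])

lemma translation_commutant:
  assumes "a \<in> commutant W U"
  shows "(translation W ^^ k) a \<in> commutant W U"
  using assms by (induction k) (auto simp: translation_def intro: commutant_nprod vacuum_in_commutant)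

lemma span_monomials_commutant:
  assumes "X \<subseteq> commutant W U"
  shows "VS.span (normally_ordered_monomials W X) \<subseteq> commutant W U"
proof (rule VS.span_minimal[OF _ subspace_commutant], rule subsetI)
  fix m assume "m \<in> normally_ordered_monomials W X"
  then obtain ks where ks: "m = foldr (\<lambda>(k, x). wick W ((translation W ^^ k) x)) ks (vacuum W)" "snd ` set ks \<subseteq> X"
    by (auto simp: normally_ordered_monomials_def)
  from ks(2) show "m \<in> commutant W U"
    unfolding ks(1)
    by (induction ks) (use assms in \<open>auto intro!: vacuum_in_commutant wick_commutant translation_commutant\<close>)
qed

lemma vacuum_in_monomials: "vacuum W \<in> normally_ordered_monomials W X"
  unfolding normally_ordered_monomials_def by (auto intro!: exI[of _ "[]"])

text \<open>Up to the factor \<open>fact k\<close>, the mode \<open>-1-k\<close> of \<open>x\<close>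
  is Wick multiplication by the \<open>k\<close>-th derivative of \<open>x\<close>, which prepends
  one factor to a monomial.\<close>

lemma mode_span_monomials:
  assumes x: "x \<in> X" and w: "w \<in> VS.span (normally_ordered_monomials W X)"
  shows "nprod W x (- 1 - int k) w \<in> VS.span (normally_ordered_monomials W X)"
proof -
  let ?M = "normally_ordered_monomials W X"
  have "VS.subspace {w. nprod W x (- 1 - int k) w \<in> VS.span ?M}"
    by (rule VS.subspaceI) (auto simp: nprod_simps intro: VS.span_add VS.span_scale VS.span_zero)
  moreover have "nprod W x (- 1 - int k) m \<in> VS.span ?M" if "m \<in> ?M" for m
  proof -
    obtain ks where ks: "m = foldr (\<lambda>(k, x). wick W ((translation W ^^ k) x)) ks (vacuum W)" "snd ` set ks \<subseteq> X"
      using \<open>m \<in> ?M\<close> by (auto simp: normally_ordered_monomials_def)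
    have "foldr (\<lambda>(k, x). wick W ((translation W ^^ k) x)) ((k, x) # ks) (vacuum W) \<in> ?M"
      unfolding normally_ordered_monomials_def using ks(2) x by (intro CollectI exI[of _ "(k, x) # ks"]) auto
    then have "wick W ((translation W ^^ k) x) m \<in> ?M" by (simp add: ks(1))
    moreover have "wick W ((translation W ^^ k) x) m = vscale W (fact k) (nprod W x (- 1 - int k) m)"
      using translation_power_mode[of k x 0 m] by (simp add: wick_def)
    ultimately have "vscale W (inverse (fact k)) (vscale W (fact k) (nprod W x (- 1 - int k) m)) \<in> VS.span ?M"
      by (metis VS.span_base VS.span_scale)
    then show ?thesis by simp
  qed
  ultimately show ?thesis
    using VS.span_induct[OF w, of "\<lambda>w. nprod W x (- 1 - int k) w \<in> VS.span ?M"] by auto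
qed

end

context sl2_fock
begin

theorem Com_eq_span:
  assumes X: "X \<subseteq> Com" and quad: "\<And>q. \<exists>a. \<exists>x\<in>X. quad_field q = vscale W a x"
  shows "Com = VS.span (normally_ordered_monomials W X)"
proof
  show sub: "VS.span (normally_ordered_monomials W X) \<subseteq> Com"
    by (rule span_monomials_commutant[OF X])
  show "Com \<subseteq> VS.span (normally_ordered_monomials W X)"
  proof (rule Com_subset[OF VS.subspace_span _ _ sub])
    show "vacuum W \<in> VS.span (normally_ordered_monomials W X)"
      by (rule VS.span_base[OF vacuum_in_monomials])
    fix q k w assume w: "w \<in> VS.span (normally_ordered_monomials W X)"
    obtain a x where "x \<in> X" "quad_field q = vscale W a x" using quad by blast
    then show "nprod W (quad_field q) (- 1 - int k) w \<in> VS.span (normally_ordered_monomials W X)"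
      using mode_span_monomials[OF _ w] VS.span_scale by (simp add: nprod_simps)
  qed
qed

end

section \<open>The beta-gamma system of the adjoint representation\<close>

context free_field
begin

lemma wick_generators_ope:
  assumes "0 \<le> n"
  shows "nprod W (wick W (g i) (g j)) n (g l) =
    (if n = 0 then vscale W (\<eta> j l) (g i) + vscale W (\<eta> i l) (g j) else 0)"
proof -
  have "nprod W (wick W (g i) (g j)) n (g l) =
      (\<Sum>a<1. nprod W (g i) (- 1 - int a) (nprod W (g j) (n + int a) (g l))
        + nprod W (g j) (n - 1 - int a) (nprod W (g i) (int a) (g l)))"
    by (rule wick_mode) (use assms in \<open>simp_all add: ope\<close>)
  then show ?thesis
    using assms by (auto simp: ope nprod_simps creation creation_regular)
qed

end

text \<open>Outside the basis the functional is zero. That case matters because folding over a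
  multiset requires the creation modes to commute for all indices, not only for basis
  vectors.\<close>

lemma sl2_dual_in_dual_space: "sl2_dual b \<in> dual_space sl2_scale"
proof (cases "b \<in> sl2_basis")
  case True
  then have "b = sl2_e \<or> b = sl2_f \<or> b = sl2_h" by (simp add: sl2_basis_def)
  then show ?thesis
    by (auto simp: dual_space_def sl2_dual_eq sl2_rep_simps intro!: linear_sl2_formI)
next
  case False
  then have "sl2_dual b = (\<lambda>_. 0)"
    using sl2.representation_ne_zero by (auto simp: dual_vec_def fun_eq_iff)
  then show ?thesis
    by (auto simp: dual_space_def intro!: linear_sl2_formI)
qed

locale sl2_beta_gamma = beta_gamma_system S sl2_scale sl2_basis \<beta> \<gamma>
  for S :: "'w::ab_group_add vertex_alg" and \<beta> :: "sl2 \<Rightarrow> 'w" and \<gamma> :: "(sl2 \<Rightarrow> complex) \<Rightarrow> 'w"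
begin

text \<open>Skew symmetry, read off by commuting a mode of \<open>\<gamma> \<phi>\<close> with
  \<open>\<beta> x\<close> at mode \<open>-1\<close> on the vacuum, which the former
  annihilates.\<close>

lemma gamma_beta_ope:
  assumes "\<phi> \<in> dual_space sl2_scale" "n \<ge> 0"
  shows "nprod S (\<gamma> \<phi>) n (\<beta> x) = (if n = 0 then vscale S (- \<phi> x) (vacuum S) else 0)"
proof -
  have "nprod S (\<beta> x) (- 1) (nprod S (\<gamma> \<phi>) n (vacuum S)) =
      nprod S (\<gamma> \<phi>) n (nprod S (\<beta> x) (- 1) (vacuum S))
      + nprod S (nprod S (\<beta> x) 0 (\<gamma> \<phi>)) (- 1 + n) (vacuum S)"
    by (rule nprod_commutator_simple_pole) (simp add: beta_gamma_ope assms)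
  then show ?thesis
    using assms by (auto simp: beta_gamma_ope creation creation_regular nprod_simps vacuum_left
        eq_neg_iff_add_eq_0 add.commute split: if_splits)
qed

section \<open>Reindexing the beta-gamma system by its six generators\<close>

definition gens :: "gen \<Rightarrow> 'w" where
  "gens = pt (\<beta> sl2_e) (\<beta> sl2_f) (\<beta> sl2_h) (\<gamma> (sl2_dual sl2_e)) (\<gamma> (sl2_dual sl2_f)) (\<gamma> (sl2_dual sl2_h))"

lemma gens_simps:
  "gens Xe = \<beta> sl2_e" "gens Xf = \<beta> sl2_f" "gens Xh = \<beta> sl2_h"
  "gens Ye = \<gamma> (sl2_dual sl2_e)" "gens Yf = \<gamma> (sl2_dual sl2_f)" "gens Yh = \<gamma> (sl2_dual sl2_h)"
  by (simp_all add: gens_def)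

sublocale free_field S gens pairing
proof
  fix n :: int and i j assume n: "n \<ge> 0"
  show "nprod S (gens i) n (gens j) = (if n = 0 then vscale S (pairing i j) (vacuum S) else 0)"
    by (cases i; cases j)
      (simp_all add: gens_simps pairing_def n beta_beta_ope gamma_gamma_ope beta_gamma_ope gamma_beta_ope
        sl2_dual_in_dual_space, simp_all add: sl2_dual_eq sl2_rep_simps)
qed

definition gen_index :: "gen \<Rightarrow> sl2 + sl2" where
  "gen_index = pt (Inl sl2_e) (Inl sl2_f) (Inl sl2_h) (Inr sl2_e) (Inr sl2_f) (Inr sl2_h)"

lemma inj_gen_index: "inj gen_index"
proof (rule injI)
  fix i j assume "gen_index i = gen_index j"
  then show "i = j"
    using sl2_basis_distinct by (cases i; cases j) (simp_all add: gen_index_def)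
qed

lemma range_gen_index: "range gen_index = sl2_basis <+> sl2_basis"
proof
  show "range gen_index \<subseteq> sl2_basis <+> sl2_basis"
  proof
    fix x assume "x \<in> range gen_index"
    then obtain i where "x = gen_index i" by blast
    then show "x \<in> sl2_basis <+> sl2_basis"
      by (cases i) (auto simp: gen_index_def sl2_basis_def)
  qed
  show "sl2_basis <+> sl2_basis \<subseteq> range gen_index"
  proof
    fix x assume "x \<in> sl2_basis <+> sl2_basis"
    then have "x \<in> {Inl sl2_e, Inl sl2_f, Inl sl2_h, Inr sl2_e, Inr sl2_f, Inr sl2_h}"
      by (auto simp: sl2_basis_def)
    then have "x \<in> gen_index ` {Xe, Xf, Xh, Ye, Yf, Yh}" by (simp add: gen_index_def)
    then show "x \<in> range gen_index" by blast
  qed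
qed

abbreviation "mode \<equiv> creation_mode S sl2_scale sl2_basis \<beta> \<gamma>"

lemma creation_mode_commute: "mode x (mode y w) = mode y (mode x w)"
proof -
  have *: "nprod S a (- int k - 1) (nprod S b (- int l - 1) w) = nprod S b (- int l - 1) (nprod S a (- int k - 1) w)"
    if "\<And>n. 0 \<le> n \<Longrightarrow> nprod S a n b = (if n = 0 then vscale S c (vacuum S) else 0)" for a b c k l
    using nprod_commutator_simple_pole[of a b "- int k - 1" "- int l - 1" w] that
    by (simp add: nprod_simps vacuum_left)
  have **: "nprod S (\<beta> x) n (\<beta> y) = (if n = 0 then vscale S 0 (vacuum S) else 0)" if "0 \<le> n" for x y n
    using that by (simp add: beta_beta_ope)
  have ***: "nprod S (\<gamma> (sl2_dual x)) n (\<gamma> (sl2_dual y)) = (if n = 0 then vscale S 0 (vacuum S) else 0)"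
    if "0 \<le> n" for x y n
    using that by (simp add: gamma_gamma_ope sl2_dual_in_dual_space)
  note gb = gamma_beta_ope[OF sl2_dual_in_dual_space] and bg = beta_gamma_ope[OF sl2_dual_in_dual_space]
  obtain a k where x: "x = (a, k)" by force
  obtain b l where y: "y = (b, l)" by force
  show ?thesis unfolding x y
    by (cases a; cases b) (simp_all only: creation_mode.simps, (rule *[OF **] *[OF ***] *[OF gb] *[OF bg], assumption)+)
qed

lemma fock_monomial_add:
  "fock_monomial S sl2_scale sl2_basis \<beta> \<gamma> (add_mset x M) = mode x (fock_monomial S sl2_scale sl2_basis \<beta> \<gamma> M)"
proof -
  interpret comp_fun_commute mode
    by standard (auto simp: fun_eq_iff creation_mode_commute)
  show ?thesis by (simp add: fock_monomial_def)
qed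

lemma fm_eq_fock_monomial:
  "fm M = fock_monomial S sl2_scale sl2_basis \<beta> \<gamma> (image_mset (map_prod gen_index id) M)"
proof (induction M)
  case empty
  show ?case by (simp add: fm_empty fock_monomial_def)
next
  case (add x M)
  obtain i k where x: "x = (i, k)" by force
  have "- 1 - int k = - int k - 1" by simp
  then have "crea i k = mode (gen_index i, k)"
    by (cases i) (simp_all only: crea_def gens_simps gen_index_def pt.simps creation_mode.simps)
  then show ?case by (simp add: x fm_add fock_monomial_add add)
qed

lemma fock_indices_eq: "fock_indices sl2_basis = range (image_mset (map_prod gen_index id))"
proof
  show "range (image_mset (map_prod gen_index id)) \<subseteq> fock_indices sl2_basis"
    unfolding fock_indices_def range_gen_index[symmetric] by auto
  show "fock_indices sl2_basis \<subseteq> range (image_mset (map_prod gen_index id))"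
  proof
    fix M :: "((sl2 + sl2) \<times> nat) multiset" assume M: "M \<in> fock_indices sl2_basis"
    have "M = image_mset (\<lambda>x. map_prod gen_index id (map_prod (inv gen_index) id x)) M"
    proof (subst multiset.map_ident[of M, symmetric], rule image_mset_cong)
      fix x assume "x \<in># M"
      then have "fst x \<in> range gen_index" using M range_gen_index by (auto simp: fock_indices_def)
      then show "x = map_prod gen_index id (map_prod (inv gen_index) id x)"
        by (cases x) (auto simp: f_inv_into_f)
    qed
    also have "\<dots> = image_mset (map_prod gen_index id) (image_mset (map_prod (inv gen_index) id) M)"
      by (simp add: multiset.map_comp comp_def)
    finally show "M \<in> range (image_mset (map_prod gen_index id))" by blast
  qed
qed

lemma range_fm: "range fm = fock_monomial S sl2_scale sl2_basis \<beta> \<gamma> ` fock_indices sl2_basis"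
  unfolding fock_indices_eq by (auto simp: fm_eq_fock_monomial)

sublocale fock_space S gens pairing
proof
  show "\<not> VS.dependent (range fm)" unfolding range_fm by (rule fock_independent)
  show "VS.span (range fm) = UNIV" unfolding range_fm by (rule fock_span)
  have "inj (map_prod gen_index (id :: nat \<Rightarrow> nat))"
    using inj_gen_index by (intro prod.inj_map) auto
  then have "inj (image_mset (map_prod gen_index (id :: nat \<Rightarrow> nat)))"
    by (rule multiset.inj_map)
  then have "inj (fock_monomial S sl2_scale sl2_basis \<beta> \<gamma> \<circ> image_mset (map_prod gen_index id))"
    using fock_inj unfolding fock_indices_eq by (rule comp_inj_on)
  then show "inj fm" by (simp add: comp_def fm_eq_fock_monomial[symmetric])
qed

abbreviation "\<theta> \<equiv> rep_current S sl2_scale sl2_basis \<beta> \<gamma> sl2_bracket"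

lemma beta_simps: "\<beta> (sl2_scale a x) = vscale S a (\<beta> x)" "\<beta> (- x) = - \<beta> x" "\<beta> 0 = 0"
proof -
  interpret l: Vector_Spaces.linear sl2_scale "vscale S" \<beta> by (rule beta_linear)
  show "\<beta> (sl2_scale a x) = vscale S a (\<beta> x)" "\<beta> (- x) = - \<beta> x" "\<beta> 0 = 0" by (rule l.scale l.neg l.zero)+
qed

lemma sl2_brackets_all:
  "sl2_bracket sl2_e sl2_e = 0" "sl2_bracket sl2_e sl2_f = sl2_h" "sl2_bracket sl2_e sl2_h = sl2_scale (-2) sl2_e"
  "sl2_bracket sl2_f sl2_e = sl2_scale (-1) sl2_h" "sl2_bracket sl2_f sl2_f = 0" "sl2_bracket sl2_f sl2_h = sl2_scale 2 sl2_f"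
  "sl2_bracket sl2_h sl2_e = sl2_scale 2 sl2_e" "sl2_bracket sl2_h sl2_f = sl2_scale (-2) sl2_f" "sl2_bracket sl2_h sl2_h = 0"
  by (auto simp: sl2_eq_iff sl2_rep_simps)

lemma rep_current_eq:
  "\<theta> sl2_e = vscale S 2 (wick S (gens Xe) (gens Yh)) - wick S (gens Xh) (gens Yf)"
  "\<theta> sl2_f = wick S (gens Xh) (gens Ye) - vscale S 2 (wick S (gens Xf) (gens Yh))"
  "\<theta> sl2_h = vscale S 2 (wick S (gens Xf) (gens Yf)) - vscale S 2 (wick S (gens Xe) (gens Ye))"
  using sl2_basis_distinct
  by (simp_all add: rep_current_def sl2_basis_def[THEN arg_cong[where f = "sum _"]] sl2_brackets_all
      beta_simps gens_simps wick_def nprod_simps)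

sublocale sl2_fock S gens "\<theta> sl2_e" "\<theta> sl2_f" "\<theta> sl2_h"
proof
  note [simp] = rep_current_eq nprod_simps pairing_def wick_generators_ope
  fix n :: int and i :: gen assume n: "n \<ge> 0"
  show "nprod S (\<theta> sl2_e) n (gens i) = (if n = 0 then vscale S (coef_e i) (gens (target_e i)) else 0)"
    using n by (cases i) simp_all
  show "nprod S (\<theta> sl2_f) n (gens i) = (if n = 0 then vscale S (coef_f i) (gens (target_f i)) else 0)"
    using n by (cases i) simp_all
  show "nprod S (\<theta> sl2_h) n (gens i) = (if n = 0 then vscale S (coef_h i) (gens i) else 0)"
    using n by (cases i) simp_all
qed

end

text \<open>By \<open>induced_surj\<close> every vector is a combination of words of current modes
  applied to the vacuum, and a homomorphism carries each such word to the corresponding word in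
  \<open>S\<close>.\<close>

lemma (in universal_affine) va_hom_range_subset:
  assumes hom: "va_hom W S \<phi>" and S: "vertex_algebra S"
    and T: "module.subspace (vscale S) T" "vacuum S \<in> T"
    and mode: "\<And>u n x. x \<in> T \<Longrightarrow> nprod S (\<phi> (J u)) n x \<in> T"
  shows "range \<phi> \<subseteq> T"
proof
  interpret S: vertex_algebra S by (rule S)
  interpret l: Vector_Spaces.linear "vscale W" "vscale S" \<phi> using hom by (simp add: va_hom_def)
  have word: "\<phi> (foldr (letter_action W J) ls (vacuum W)) \<in> T" for ls
  proof (induction ls)
    case Nil
    then show ?case using hom T(2) by (simp add: va_hom_def)
  next
    case (Cons x ls)
    then show ?case using hom mode by (cases x) (auto simp: va_hom_def)
  qed
  fix y assume "y \<in> range \<phi>"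
  then obtain p where p: "y = \<phi> (free_action W J p)" using induced_surj by (metis rangeE surjD)
  show "y \<in> T"
    unfolding p free_action_def l.sum l.scale
    by (intro S.VS.subspace_sum S.VS.subspace_scale T word)
qed

lemma (in vertex_algebra) linear_image_current:
  assumes hom: "va_hom U W \<phi>" and J: "Vector_Spaces.linear sl2_scale (vscale U) J"
    and T: "VS.subspace T" and gens: "\<phi> (J sl2_e) \<in> T" "\<phi> (J sl2_f) \<in> T" "\<phi> (J sl2_h) \<in> T"
  shows "\<phi> (J u) \<in> T"
proof -
  interpret l: Vector_Spaces.linear "vscale U" "vscale W" \<phi> using hom by (simp add: va_hom_def)
  interpret J: Vector_Spaces.linear sl2_scale "vscale U" J by (rule J)
  show ?thesis
    by (subst sl2_expand[of u, symmetric], unfold J.add J.scale l.add l.scale)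
      (intro VS.subspace_add VS.subspace_scale T gens)
qed

theorem theorem5p3:
  fixes S :: "'w::ab_group_add vertex_alg"
    and \<beta> :: "sl2 \<Rightarrow> 'w" and \<gamma> :: "(sl2 \<Rightarrow> complex) \<Rightarrow> 'w"
    and O1 :: "'a::ab_group_add vertex_alg" and J1 :: "sl2 \<Rightarrow> 'a"
    and O2 :: "'b::ab_group_add vertex_alg" and J2 :: "sl2 \<Rightarrow> 'b"
    and rho_hat :: "'a \<Rightarrow> 'w" and psi_hat :: "'b \<Rightarrow> 'w"
    and \<Theta> \<A> :: "'w set" and ve vf vh :: 'w
  assumes S: "beta_gamma_system S sl2_scale sl2_basis \<beta> \<gamma>"
    and O1: "universal_affine O1 sl2_scale sl2_bracket (\<lambda>u v. - sl2_killing u v) J1"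
    and rho_hat: "va_hom O1 S rho_hat"
      "\<And>u. rho_hat (J1 u) = rep_current S sl2_scale sl2_basis \<beta> \<gamma> sl2_bracket u"
    and \<Theta>: "\<Theta> = range rho_hat"
    and ve: "ve = vscale S 4 (wick S (\<gamma> (sl2_dual sl2_h)) (\<gamma> (sl2_dual sl2_h))
                   + wick S (\<gamma> (sl2_dual sl2_e)) (\<gamma> (sl2_dual sl2_f)))"
    and vf: "vf = vscale S (- 1 / 16) (wick S (\<beta> sl2_h) (\<beta> sl2_h)
                   + vscale S 4 (wick S (\<beta> sl2_e) (\<beta> sl2_f)))"
    and vh: "vh = wick S (\<beta> sl2_h) (\<gamma> (sl2_dual sl2_h)) + wick S (\<beta> sl2_e) (\<gamma> (sl2_dual sl2_e))
                   + wick S (\<beta> sl2_f) (\<gamma> (sl2_dual sl2_f))"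
    and O2: "universal_affine O2 sl2_scale sl2_bracket (\<lambda>u v. - (3 / 8) * sl2_killing u v) J2"
    and psi_hat: "va_hom O2 S psi_hat"
      "psi_hat (J2 sl2_e) = ve" "psi_hat (J2 sl2_f) = vf" "psi_hat (J2 sl2_h) = vh"
    and \<A>: "\<A> = range psi_hat"
  shows "strongly_generates S {ve, vf, vh} (commutant S \<Theta>) \<and> commutant S \<Theta> = \<A>"
proof -
  interpret beta_gamma_system S sl2_scale sl2_basis \<beta> \<gamma> by (rule S)
  interpret sl2_beta_gamma S \<beta> \<gamma> ..
  interpret O1: universal_affine O1 sl2_scale sl2_bracket "\<lambda>u v. - sl2_killing u v" J1 by (rule O1)
  interpret O2: universal_affine O2 sl2_scale sl2_bracket "\<lambda>u v. - (3 / 8) * sl2_killing u v" J2 by (rule O2)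
  have VA: "vertex_algebra S" by unfold_locales
  have Theta: "commutant S \<Theta> = Com"
  proof
    have "{\<theta> sl2_e, \<theta> sl2_f, \<theta> sl2_h} \<subseteq> \<Theta>"
      unfolding \<Theta> by (auto simp: rho_hat(2)[symmetric])
    then show "commutant S \<Theta> \<subseteq> Com" by (auto simp: commutant_def)
    show "Com \<subseteq> commutant S \<Theta>"
    proof
      fix v assume v: "v \<in> Com"
      \<comment> \<open>The vectors whose non-negative modes kill \<open>v\<close>. This subspace is
        closed under the products with the currents, so it contains all of \<open>\<Theta>\<close>
        as soon as it contains the three basis currents.\<close>
      let ?T = "{a. \<forall>n\<ge>0. nprod S a n v = 0}"
      have cur: "rho_hat (J1 u) \<in> ?T" for u
        by (rule linear_image_current[OF rho_hat(1) O1.current_linear subspace_annihilator])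
          (use v in \<open>simp_all add: rho_hat(2) commutant_def\<close>)
      have "range rho_hat \<subseteq> ?T"
        by (rule O1.va_hom_range_subset[OF rho_hat(1) VA subspace_annihilator])
          (use cur in \<open>auto simp: vacuum_left intro: annihilator_nprod\<close>)
      then show "v \<in> commutant S \<Theta>" by (auto simp: commutant_def \<Theta>)
    qed
  qed
  have quads: "ve = vscale S 4 (quad_field QE)" "vf = vscale S (- 1 / 16) (quad_field QF)" "vh = quad_field QH"
    by (simp_all only: ve vf vh quad_field.simps gens_simps)
  have X: "{ve, vf, vh} \<subseteq> Com"
    unfolding quads by (simp only: insert_subset empty_subsetI)
      (intro conjI TrueI quad_field_in_Com VS.subspace_scale[OF subspace_commutant])
  have span: "Com = VS.span (normally_ordered_monomials S {ve, vf, vh})"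
  proof (rule Com_eq_span[OF X])
    fix q
    have "quad_field QE = vscale S (1 / 4) ve" "quad_field QF = vscale S (- 16) vf" "quad_field QH = vscale S 1 vh"
      by (simp_all add: quads del: quad_field.simps)
    then show "\<exists>a. \<exists>x\<in>{ve, vf, vh}. quad_field q = vscale S a x"
      by (cases q) (blast+)
  qed
  interpret l: Vector_Spaces.linear "vscale O2" "vscale S" psi_hat using psi_hat(1) by (simp add: va_hom_def)
  have "\<A> \<subseteq> Com"
    unfolding \<A>
  proof (rule O2.va_hom_range_subset[OF psi_hat(1) VA subspace_commutant vacuum_in_commutant])
    have "psi_hat (J2 u) \<in> Com" for u
      by (rule linear_image_current[OF psi_hat(1) O2.current_linear subspace_commutant])
        (use X in \<open>simp_all add: psi_hat\<close>)
    then show "nprod S (psi_hat (J2 u)) n x \<in> Com" if "x \<in> Com" for u n x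
      by (rule commutant_nprod[OF _ that])
  qed
  moreover have "Com \<subseteq> \<A>"
  proof -
    \<comment> \<open>The image of a homomorphism is closed under all products, hence under
      translation and Wick products, so it contains the normally ordered monomials in its
      elements.\<close>
    have np: "nprod S a n b \<in> \<A>" if ab: "a \<in> \<A>" "b \<in> \<A>" for a n b
    proof -
      obtain a' b' where "a = psi_hat a'" "b = psi_hat b'" using ab by (auto simp: \<A>)
      then have "nprod S a n b = psi_hat (nprod O2 a' n b')" using psi_hat(1) by (simp add: va_hom_def)
      then show ?thesis by (simp add: \<A>)
    qed
    have vac: "vacuum S \<in> \<A>" using psi_hat(1) unfolding \<A> va_hom_def by (metis rangeI)
    have tr: "(translation S ^^ k) a \<in> \<A>" if "a \<in> \<A>" for a k
      using that by (induction k) (auto simp: translation_def intro: np vac)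
    have gens: "{ve, vf, vh} \<subseteq> \<A>" unfolding \<A> psi_hat(2-4)[symmetric] by auto
    have "normally_ordered_monomials S {ve, vf, vh} \<subseteq> \<A>"
    proof
      fix m assume "m \<in> normally_ordered_monomials S {ve, vf, vh}"
      then obtain ks where ks: "m = foldr (\<lambda>(k, x). wick S ((translation S ^^ k) x)) ks (vacuum S)"
        "snd ` set ks \<subseteq> {ve, vf, vh}" unfolding normally_ordered_monomials_def by blast
      from ks(2) have "snd ` set ks \<subseteq> \<A>" using gens by blast
      then show "m \<in> \<A>" unfolding ks(1)
        by (induction ks) (auto simp: wick_def intro!: vac np tr)
    qed
    moreover have "VS.subspace \<A>"
      unfolding \<A> by (rule l.subspace_image) (rule O2.VS.subspace_UNIV)
    ultimately show ?thesis unfolding span by (rule VS.span_minimal)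
  qed
  ultimately have "Com = \<A>" by blast
  then show ?thesis
    using X span by (simp add: strongly_generates_def Theta)
qed

end
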